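(* Let $\mathcal{P}$ be a class of distributions on $W\times C$. Suppose that the surrogate loss $\ell$ is $\mathcal{P}$-uniformly calibrated and that $B_C<\infty$. Define $$\delta_\ell^{**}(\epsilon;\mathcal{P}):=\sup_{h'}\left\{h'(\epsilon):\ h'\text{ convex function on }\mathbb{R},\ h'\le\delta_\ell(\cdot;\mathcal{P})\text{ pointwise on }(0,B_f+B_CB_X]\right\}.$$ Then $\delta_\ell^{**}(\epsilon;\mathcal{P})$ is positive for $\epsilon\in(0,B_f+B_CB_X]$, and for any $\mathbb{P}\in\mathcal{P}$ and (measurable) $g:W\to\mathbb{R}^m$, $$\delta_\ell^{**}\left(R(g,\mathbb{P})-R(\mathbb{P});\mathcal{P}\right)\le R_\ell(g,\mathbb{P})-R_\ell(\mathbb{P}).$$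
   Context: Setting: $X\subset\mathbb{R}^m$ is a non-empty convex compact set; $f:X\to\mathbb{R}$ is convex and continuous; $W\subseteq\mathbb{R}^k$ and $C\subseteq\mathbb{R}^m$ are given sets. Put $B_X:=\max_{x,x'\in X}\|x-x'\|_2$, $B_f:=\max_{x,x'\in X}\{f(x)-f(x')\}$, $B_C:=\max_{c\in C}\|c\|_2$ (which may be infinite in general). For $d\in\mathbb{R}^m$, $X^*(d):=\operatorname{argmin}_{x\in X}\{f(x)+d^\top x\}$, and $x^*:\mathbb{R}^m\to X$ is a fixed function with $x^*(d)\in X^*(d)$ for all $d$ (any such selection is Lebesgue measurable). The true loss is $L(d,c):=f(x^*(d))+c^\top x^*(d)-\min_{x\in X}\{f(x)+c^\top x\}$. Probability distributions $\mathbb{P}$ on $W\times C$ are defined on the $\sigma$-algebra of Lebesgue measurable sets; measurability is in the sense of Lebesgue; $(w,c)\sim\mathbb{P}$, and $\mathbb{E}[\cdot\mid w]$ is conditional expectation given $w$ under $\mathbb{P}$. For measurable $g:W\to\mathbb{R}^m$: $R(g,\mathbb{P}):=\mathbb{E}[L(g(w),c)]$, $R(\mathbb{P}):=\inf_g R(g,\mathbb{P})$, $R_\ell(g,\mathbb{P}):=\mathbb{E}[\ell(g(w),c)]$, $R_\ell(\mathbb{P}):=\inf_g R_\ell(g,\mathbb{P})$, with infima over measurable $g$. A surrogate loss is a measurable real-valued function $\ell(d,c)$ of $d,c\in\mathbb{R}^m$. $\ell$ is $\mathcal{P}$-uniformly calibrated if for all $\epsilon>0$ there exists $\delta>0$ such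 that for all $\mathbb{P}\in\mathcal{P}$, $w\in W$ and $d\in\mathbb{R}^m$: $\mathbb{E}[\ell(d,c)\mid w]-\inf_{d'}\mathbb{E}[\ell(d',c)\mid w]<\delta$ implies $\mathbb{E}[L(d,c)\mid w]-\inf_{d'}\mathbb{E}[L(d',c)\mid w]<\epsilon$. The function $\delta_\ell$ is $$\delta_\ell(\epsilon;\mathcal{P}):=\inf_{d\in\mathbb{R}^m,\,w\in W,\,\mathbb{P}\in\mathcal{P}}\left\{\mathbb{E}[\ell(d,c)\mid w]-\min_{d'\in\mathbb{R}^m}\mathbb{E}[\ell(d',c)\mid w]:\ \mathbb{E}[L(d,c)\mid w]-\min_{d'\in\mathbb{R}^m}\mathbb{E}[L(d',c)\mid w]\ge\epsilon\right\},$$ where the infimum over an empty set is $+\infty$.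
   Formalization: The bound h' ≤ δ_ℓ is required on [0, B_f+B_C B_X] instead of (0, B_f+B_C B_X] (the literal risk bound is false); ℓ is jointly Borel measurable, and g (also in R(P)) is restricted to measurable g with x*(g(w)) measurable, so that the expectations are defined. *)

theory Defs
  imports "HOL-Probability.Probability"
begin

section \<open>The optimization problem and the true loss\<close>

definition sol_set :: "'a::euclidean_space set \<Rightarrow> ('a \<Rightarrow> real) \<Rightarrow> 'a \<Rightarrow> 'a set" where
  "sol_set X f d = {x. is_arg_min (\<lambda>x. f x + d \<bullet> x) (\<lambda>x. x \<in> X) x}"

text \<open>The argument \<open>xs\<close> is the fixed selection of optimal solutions, \<open>xs d \<in> sol_set X f d\<close>.\<close>

definition true_loss ::
  "'a::euclidean_space set \<Rightarrow> ('a \<Rightarrow> real) \<Rightarrow> ('a \<Rightarrow> 'a) \<Rightarrow> 'a \<Rightarrow> 'a \<Rightarrow> real" where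
  "true_loss X f xs d c = f (xs d) + c \<bullet> xs d - (INF x\<in>X. f x + c \<bullet> x)"

definition B_X :: "'a::euclidean_space set \<Rightarrow> real" where
  "B_X X = (SUP (x, x')\<in>X \<times> X. norm (x - x'))"

definition B_f :: "'a set \<Rightarrow> ('a \<Rightarrow> real) \<Rightarrow> real" where
  "B_f X f = (SUP (x, x')\<in>X \<times> X. f x - f x')"

definition B_C :: "'a::euclidean_space set \<Rightarrow> ereal" where
  "B_C C = (SUP c\<in>C. ereal (norm c))"

definition regret_bound :: "'a::euclidean_space set \<Rightarrow> ('a \<Rightarrow> real) \<Rightarrow> 'a set \<Rightarrow> ereal" where
  "regret_bound X f C = ereal (B_f X f) + B_C C * ereal (B_X X)"


section \<open>Distributions, conditional distributions, expectations\<close>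

definition distribution_on :: "'w::euclidean_space set \<Rightarrow> 'c::euclidean_space set \<Rightarrow> ('w \<times> 'c) measure \<Rightarrow> bool" where
  "distribution_on W C P \<longleftrightarrow> prob_space P \<and> sets P = sets (lebesgue_on (W \<times> C))"

text \<open>
  Uniform calibration evaluates \<open>E[h(c) | w]\<close> at every single \<open>w \<in> W\<close>, so one has to
  fix a version of the conditional expectations, coherent in the (uncountably many) integrands.
  This is a regular conditional distribution of \<open>c\<close> given \<open>w\<close>: then
  \<open>E[h(c) | w]\<close> is the integral of \<open>h\<close> against \<open>\<kappa> w\<close>. It is only needed on the Borel subsets
  of \<open>C\<close>.
\<close>

definition cond_distribution ::
  "'w::euclidean_space set \<Rightarrow> 'c::euclidean_space set \<Rightarrow> ('w \<times> 'c) measure \<Rightarrow> ('w \<Rightarrow> 'c measure) \<Rightarrow> bool" where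
  "cond_distribution W C P \<kappa> \<longleftrightarrow>
     \<kappa> \<in> lebesgue_on W \<rightarrow>\<^sub>M prob_algebra (restrict_space borel C) \<and>
     (\<forall>A\<in>sets (lebesgue_on W). \<forall>B\<in>sets (restrict_space borel C).
        emeasure P (A \<times> B) = (\<integral>\<^sup>+z. emeasure (\<kappa> (fst z)) B * indicator A (fst z) \<partial>P))"

text \<open>
  A surrogate loss is an arbitrary real-valued function, so its expectations need not be finite.
  The extended integral below uses the usual convention of minimization, \<open>\<infinity> - \<infinity> = \<infinity>\<close> (which is
  how subtraction on \<^typ>\<open>ereal\<close> is defined), and is the Bochner integral
  whenever the integrand is integrable.
\<close>

definition expect :: "'a measure \<Rightarrow> ('a \<Rightarrow> real) \<Rightarrow> ereal" where
  "expect M h = enn2ereal (\<integral>\<^sup>+x. ennreal (h x) \<partial>M) - enn2ereal (\<integral>\<^sup>+x. ennreal (- h x) \<partial>M)"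

lemma expect_eq_integral:
  assumes "integrable M h"
  shows "expect M h = ereal (integral\<^sup>L M h)"
proof -
  have fin: "(\<integral>\<^sup>+x. ennreal (h x) \<partial>M) < \<top>" "(\<integral>\<^sup>+x. ennreal (- h x) \<partial>M) < \<top>"
    using assms by (auto simp: real_integrable_def less_top)
  have "enn2ereal y = ereal (enn2real y)" if "y < \<top>" for y
    using that by (cases y) auto
  with fin show ?thesis
    by (simp add: expect_def real_lebesgue_integral_def[OF assms])
qed


section \<open>Risks and regrets\<close>

definition risk ::
  "('c \<Rightarrow> 'c \<Rightarrow> real) \<Rightarrow> ('w \<times> 'c) measure \<Rightarrow> ('w \<Rightarrow> 'c) \<Rightarrow> ereal" where
  "risk loss P g = expect P (\<lambda>(w, c). loss (g w) c)"

definition opt_risk ::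
  "('w \<Rightarrow> 'c) set \<Rightarrow> ('c \<Rightarrow> 'c \<Rightarrow> real) \<Rightarrow> ('w \<times> 'c) measure \<Rightarrow> ereal" where
  "opt_risk G loss P = (INF g\<in>G. risk loss P g)"

definition predictors :: "'w::euclidean_space set \<Rightarrow> ('w \<Rightarrow> 'c::euclidean_space) set" where
  "predictors W = borel_measurable (lebesgue_on W)"

text \<open>
  A selection \<open>xs\<close> is Lebesgue measurable, but in general not Borel measurable, so that
  \<open>xs (g w)\<close>, and with it the true loss of a measurable \<open>g\<close>, may fail to be
  measurable. The true risk is defined for those \<open>g\<close> for which \<open>xs (g w)\<close> is measurable; for Borel
  measurable \<open>xs\<close> these are all measurable \<open>g\<close>.
\<close>

definition true_predictors ::
  "'w::euclidean_space set \<Rightarrow> ('c \<Rightarrow> 'c) \<Rightarrow> ('w \<Rightarrow> 'c::euclidean_space) set" where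
  "true_predictors W xs = {g \<in> predictors W. (\<lambda>w. xs (g w)) \<in> borel_measurable (lebesgue_on W)}"

lemma true_predictors_borel:
  "xs \<in> borel_measurable borel \<Longrightarrow> true_predictors W xs = predictors W"
  by (auto simp: true_predictors_def predictors_def)

text \<open>The argument \<open>Q\<close> of the following two is the conditional distribution of \<open>c\<close> at some \<open>w\<close>.\<close>

definition cond_risk :: "('c \<Rightarrow> 'c \<Rightarrow> real) \<Rightarrow> 'c measure \<Rightarrow> 'c \<Rightarrow> ereal" where
  "cond_risk loss Q d = expect Q (\<lambda>c. loss d c)"

definition cond_regret :: "('c \<Rightarrow> 'c \<Rightarrow> real) \<Rightarrow> 'c measure \<Rightarrow> 'c \<Rightarrow> ereal" where
  "cond_regret loss Q d = cond_risk loss Q d - (INF d'. cond_risk loss Q d')"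


section \<open>Uniform calibration\<close>

text \<open>\<open>\<kappa> P w\<close> is the conditional distribution of \<open>c\<close> given \<open>w\<close> under \<open>P\<close>, \<open>L\<close> the true loss,
  \<open>l\<close> the surrogate loss.\<close>

definition uniformly_calibrated ::
  "'w set \<Rightarrow> (('w \<times> 'c) measure \<Rightarrow> 'w \<Rightarrow> 'c measure) \<Rightarrow> ('w \<times> 'c) measure set \<Rightarrow>
   ('c \<Rightarrow> 'c \<Rightarrow> real) \<Rightarrow> ('c \<Rightarrow> 'c \<Rightarrow> real) \<Rightarrow> bool" where
  "uniformly_calibrated W \<kappa> \<P> L l \<longleftrightarrow>
     (\<forall>\<epsilon>::real. \<epsilon> > 0 \<longrightarrow> (\<exists>\<delta>::real. \<delta> > 0 \<and>
        (\<forall>P\<in>\<P>. \<forall>w\<in>W. \<forall>d.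
           cond_regret l (\<kappa> P w) d < ereal \<delta> \<longrightarrow> cond_regret L (\<kappa> P w) d < ereal \<epsilon>)))"

definition calibration_fun ::
  "'w set \<Rightarrow> (('w \<times> 'c) measure \<Rightarrow> 'w \<Rightarrow> 'c measure) \<Rightarrow> ('w \<times> 'c) measure set \<Rightarrow>
   ('c \<Rightarrow> 'c \<Rightarrow> real) \<Rightarrow> ('c \<Rightarrow> 'c \<Rightarrow> real) \<Rightarrow> real \<Rightarrow> ereal" where
  "calibration_fun W \<kappa> \<P> L l \<epsilon> =
     Inf {cond_regret l (\<kappa> P w) d | d w P.
            w \<in> W \<and> P \<in> \<P> \<and> cond_regret L (\<kappa> P w) d \<ge> ereal \<epsilon>}"

definition convex_envelope :: "real set \<Rightarrow> (real \<Rightarrow> ereal) \<Rightarrow> real \<Rightarrow> ereal" where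
  "convex_envelope I u \<epsilon> =
     (SUP h\<in>{h. convex_on UNIV h \<and> (\<forall>t\<in>I. ereal (h t) \<le> u t)}. ereal (h \<epsilon>))"

text \<open>
  The interval includes \<open>0\<close>, where the calibration function is \<open>0\<close> as soon as
  conditional surrogate regrets come arbitrarily close to \<open>0\<close>. Without this
  constraint the envelope can be positive at \<open>0\<close>, if the calibration function does not tend
  to \<open>0\<close> at \<open>0\<close>, and it is then not a lower bound on the surrogate regret.
\<close>

definition calibration_envelope ::
  "'c::euclidean_space set \<Rightarrow> ('c \<Rightarrow> real) \<Rightarrow> ('c \<Rightarrow> 'c) \<Rightarrow> 'w set \<Rightarrow> 'c set \<Rightarrow>
   (('w \<times> 'c) measure \<Rightarrow> 'w \<Rightarrow> 'c measure) \<Rightarrow> ('w \<times> 'c) measure set \<Rightarrow>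
   ('c \<Rightarrow> 'c \<Rightarrow> real) \<Rightarrow> real \<Rightarrow> ereal" where
  "calibration_envelope X f xs W C \<kappa> \<P> l =
     convex_envelope {t. 0 \<le> t \<and> ereal t \<le> regret_bound X f C}
       (calibration_fun W \<kappa> \<P> (true_loss X f xs) l)"

end

theory Submission
  imports Defs
begin

text \<open>
  Conditionally on \<open>w\<close>, the regret of the true loss is \<open>L(d, m(w))\<close>, where \<open>m(w)\<close> is the conditional
  mean of \<open>c\<close>, so it lies in \<open>[0, B_f + B_C B_X]\<close> and is bounded by the surrogate regret through any
  convex \<open>h \<le> \<delta>\<close>. Integrating over \<open>w\<close>, Jensen's inequality moves \<open>h\<close> outside on the side
  of the true loss. On the side of the surrogate loss one needs that the expected conditional regret is at most
  the regret, that is, that infimum over \<open>d\<close> and integral over \<open>w\<close> may be interchanged. As \<open>\<ell>\<close> is only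
  jointly measurable, this rests on the measurable selection theorem of Aumann and von Neumann.
  It is proved here by Choquet's capacity argument: the projection of a Suslin set is exhausted,
  up to small outer measure, by projections of sets with compact sections, and from compact
  sections one selects the lexicographic minimum.
\<close>

section \<open>Measurable selection\<close>

text \<open>Given \<open>w\<close>, the true loss is affine in \<open>c\<close> up to the term
  \<open>opt_val c\<close>, which does not involve the decision. Hence only the conditional mean
  matters, and \<open>post_mean\<close> is optimal at every \<open>w\<close>. It need not lie in
  \<open>true_predictors W xs\<close>, however, so the true regret is only bounded above by the mean
  of the conditional regrets, and the convex minorant must be nondecreasing on the nonnegative reals
  before Jensen's inequality can be used. This is where the value of the calibration function at 0
  enters. The conditional surrogate regret is an infimum over uncountably many \<open>d\<close> and
  need not be measurable in \<open>w\<close>. What gets integrated is therefore a measurable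
  minorant \<open>v\<close>, in the main case a convex function of the conditional true regret. The
  infimum need not be attained either, so near-minimizers are selected with a slack \<eta> that is
  removed at the end. Only integrals against the marginal are compared, so a selection valid almost
  everywhere is enough. Positivity is independent of all this: the calibration function is
  nondecreasing and positive away from 0, so a ramp that starts at \<open>\<epsilon> / 2\<close>
  fits below it.\<close>

text \<open>This is the Suslin operation: a scheme indexed by finite prefixes, with a union over all
  infinite branches. The index \<open>n = 0\<close> is included, so \<open>R []\<close> contains the
  whole set.\<close>

definition suslin_sets :: "'a set set \<Rightarrow> 'a set set" where
  "suslin_sets \<R> = {S. \<exists>R. range R \<subseteq> \<R> \<and> S = {z. \<exists>\<sigma>::nat \<Rightarrow> nat. \<forall>n. z \<in> R (map \<sigma> [0..<n])}}"

lemma suslin_setsI: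
  assumes "\<And>xs. R xs \<in> \<R>" "S = {z. \<exists>\<sigma>::nat \<Rightarrow> nat. \<forall>n. z \<in> R (map \<sigma> [0..<n])}"
  shows "S \<in> suslin_sets \<R>"
  unfolding suslin_sets_def mem_Collect_eq using assms by (intro exI[of _ R] conjI) auto

lemma suslin_setsE:
  assumes "S \<in> suslin_sets \<R>"
  obtains R where "range R \<subseteq> \<R>" "S = {z. \<exists>\<sigma>::nat \<Rightarrow> nat. \<forall>n. z \<in> R (map \<sigma> [0..<n])}"
proof -
  from assms obtain R where "range R \<subseteq> \<R>" "S = {z. \<exists>\<sigma>::nat \<Rightarrow> nat. \<forall>n. z \<in> R (map \<sigma> [0..<n])}"
    unfolding suslin_sets_def mem_Collect_eq by (elim exE conjE)
  then show ?thesis by (intro that[of R]) auto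
qed

lemma suslin_sets_basic: "A \<in> \<R> \<Longrightarrow> A \<in> suslin_sets \<R>"
  by (rule suslin_setsI[where R="\<lambda>_. A"]) auto

lemma suslin_sets_UN:
  fixes S :: "nat \<Rightarrow> 'a set"
  assumes S: "\<And>k. S k \<in> suslin_sets \<R>" and \<Omega>: "\<Omega> \<in> \<R>" "\<And>A. A \<in> \<R> \<Longrightarrow> A \<subseteq> \<Omega>"
  shows "(\<Union>k. S k) \<in> suslin_sets \<R>"
proof -
  have "\<forall>k. \<exists>R. (\<forall>xs. R xs \<in> \<R>) \<and> S k = {z. \<exists>\<sigma>::nat \<Rightarrow> nat. \<forall>n. z \<in> R (map \<sigma> [0..<n])}"
    by (intro allI, rule suslin_setsE[OF S], intro exI conjI) auto
  then obtain R where
    "\<forall>k. (\<forall>xs. R k xs \<in> \<R>) \<and> S k = {z. \<exists>\<sigma>::nat \<Rightarrow> nat. \<forall>n. z \<in> R k (map \<sigma> [0..<n])}"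
    by (rule exE[OF choice])
  then have R: "\<And>k xs. R k xs \<in> \<R>"
    and eq: "\<And>k. S k = {z. \<exists>\<sigma>::nat \<Rightarrow> nat. \<forall>n. z \<in> R k (map \<sigma> [0..<n])}"
    by auto
  \<comment> \<open>The first entry of a branch picks the set \<open>S k\<close>, the remaining
    entries form a branch of its scheme. The empty prefix gets \<open>\<Omega>\<close>, which
    contains every member of the class, so \<open>n = 0\<close> costs nothing.\<close>
  define R' where "R' xs = (case xs of [] \<Rightarrow> \<Omega> | k # ys \<Rightarrow> R k ys)" for xs
  have R'_Suc: "R' (map \<sigma> [0..<Suc n]) = R (\<sigma> 0) (map (\<lambda>i. \<sigma> (Suc i)) [0..<n])" for \<sigma> n
    unfolding map_upt_Suc by (simp add: R'_def)
  show ?thesis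
  proof (rule suslin_setsI)
    show "R' xs \<in> \<R>" for xs
      using R \<Omega> by (auto simp: R'_def split: list.split)
    show "(\<Union>k. S k) = {z. \<exists>\<sigma>. \<forall>n. z \<in> R' (map \<sigma> [0..<n])}"
    proof (intro set_eqI iffI)
      fix z assume "z \<in> (\<Union>k. S k)"
      then obtain k \<sigma> where *: "\<forall>n. z \<in> R k (map \<sigma> [0..<n])"
        by (auto simp: eq)
      have "z \<in> R' (map (case_nat k \<sigma>) [0..<n])" for n
      proof (cases n)
        case 0
        then show ?thesis using *[rule_format, of 0] R \<Omega>(2) by (auto simp: R'_def)
      next
        case (Suc n')
        then show ?thesis using * unfolding Suc R'_Suc by simp
      qed
      then show "z \<in> {z. \<exists>\<sigma>. \<forall>n. z \<in> R' (map \<sigma> [0..<n])}" by blast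
    next
      fix z assume "z \<in> {z. \<exists>\<sigma>. \<forall>n. z \<in> R' (map \<sigma> [0..<n])}"
      then obtain \<sigma> where "\<forall>n. z \<in> R' (map \<sigma> [0..<n])" by blast
      then have "\<forall>n. z \<in> R (\<sigma> 0) (map (\<lambda>i. \<sigma> (Suc i)) [0..<n])"
        using R'_Suc by blast
      then show "z \<in> (\<Union>k. S k)" unfolding eq by blast
    qed
  qed
qed

lemma INT_mem_of_Int_closed:
  assumes "finite I" "I \<noteq> {}" "\<And>i. i \<in> I \<Longrightarrow> F i \<in> \<R>" "\<And>A B. A \<in> \<R> \<Longrightarrow> B \<in> \<R> \<Longrightarrow> A \<inter> B \<in> \<R>"
  shows "(\<Inter>i\<in>I. F i) \<in> \<R>"
  using assms(1,2,3)
proof (induction I rule: finite_ne_induct)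
  case (insert i I)
  then show ?case using assms(4)[of "F i" "\<Inter>i\<in>I. F i"] by simp
qed auto

text \<open>Countably many branches, one for each \<open>k\<close>, are coded into a single branch
  through the pairing function \<open>prod_encode\<close>.\<close>

lemma suslin_sets_INT:
  fixes S :: "nat \<Rightarrow> 'a set"
  assumes S: "\<And>k. S k \<in> suslin_sets \<R>" and Int: "\<And>A B. A \<in> \<R> \<Longrightarrow> B \<in> \<R> \<Longrightarrow> A \<inter> B \<in> \<R>"
  shows "(\<Inter>k. S k) \<in> suslin_sets \<R>"
proof -
  have "\<forall>k. \<exists>R. (\<forall>xs. R xs \<in> \<R>) \<and> S k = {z. \<exists>\<sigma>::nat \<Rightarrow> nat. \<forall>n. z \<in> R (map \<sigma> [0..<n])}"
    by (intro allI, rule suslin_setsE[OF S], intro exI conjI) auto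
  then obtain R where
    "\<forall>k. (\<forall>xs. R k xs \<in> \<R>) \<and> S k = {z. \<exists>\<sigma>::nat \<Rightarrow> nat. \<forall>n. z \<in> R k (map \<sigma> [0..<n])}"
    by (rule exE[OF choice])
  then have R: "\<And>k xs. R k xs \<in> \<R>"
    and eq: "\<And>k. S k = {z. \<exists>\<sigma>::nat \<Rightarrow> nat. \<forall>n. z \<in> R k (map \<sigma> [0..<n])}"
    by auto
  \<comment> \<open>\<open>I l\<close> collects the conditions \<open>(k, n)\<close> whose coded
    entries are all known from a prefix of length \<open>l\<close>. The bounds by \<open>l\<close>
    keep it finite; \<open>(0, 0)\<close> belongs to it even for \<open>l = 0\<close>, so the
    intersection below is never empty.\<close>
  define I where "I l = {(k, n). k \<le> l \<and> n \<le> l \<and> (\<forall>i<n. prod_encode (k, i) < l)}" for l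
  define R' where "R' xs = (\<Inter>(k, n)\<in>I (length xs). R k (map (\<lambda>i. xs ! prod_encode (k, i)) [0..<n]))" for xs
  have finI: "finite (I l)" for l
    by (rule finite_subset[of _ "{..l} \<times> {..l}"]) (auto simp: I_def)
  have R'_eq: "R' (map \<sigma> [0..<l]) = (\<Inter>(k, n)\<in>I l. R k (map (\<lambda>i. \<sigma> (prod_encode (k, i))) [0..<n]))" for \<sigma> l
    unfolding R'_def by (intro INF_cong) (auto simp: I_def intro!: arg_cong[where f="R _"])
  show ?thesis
  proof (rule suslin_setsI)
    show "R' xs \<in> \<R>" for xs
      unfolding R'_def
    proof (rule INT_mem_of_Int_closed)
      show "I (length xs) \<noteq> {}" by (auto simp: I_def)
    qed (use finI R Int in auto)
    show "(\<Inter>k. S k) = {z. \<exists>\<sigma>. \<forall>n. z \<in> R' (map \<sigma> [0..<n])}"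
    proof (intro set_eqI iffI)
      fix z assume "z \<in> (\<Inter>k. S k)"
      then have "\<forall>k. \<exists>\<sigma>. \<forall>n. z \<in> R k (map \<sigma> [0..<n])" by (auto simp: eq)
      then obtain \<sigma> where *: "\<And>k n. z \<in> R k (map (\<sigma> k) [0..<n])" by metis
      define \<tau> where "\<tau> j = (case prod_decode j of (k, i) \<Rightarrow> \<sigma> k i)" for j
      have "z \<in> R' (map \<tau> [0..<n])" for n
        unfolding R'_eq using * by (auto simp: \<tau>_def)
      then show "z \<in> {z. \<exists>\<sigma>. \<forall>n. z \<in> R' (map \<sigma> [0..<n])}" by blast
    next
      fix z assume "z \<in> {z. \<exists>\<sigma>. \<forall>n. z \<in> R' (map \<sigma> [0..<n])}"
      then obtain \<sigma> where *: "\<And>n. z \<in> R' (map \<sigma> [0..<n])" by blast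
      have "z \<in> R k (map (\<lambda>i. \<sigma> (prod_encode (k, i))) [0..<n])" for k n
      proof -
        define l where "l = Suc (k + n + (\<Sum>i<n. prod_encode (k, i)))"
        have "prod_encode (k, i) < l" if "i < n" for i
          using member_le_sum[of i "{..<n}" "\<lambda>i. prod_encode (k, i)"] that by (simp add: l_def)
        then have "(k, n) \<in> I l" by (auto simp: I_def l_def)
        then show ?thesis using *[of l] unfolding R'_eq by blast
      qed
      then show "z \<in> (\<Inter>k. S k)" unfolding eq by blast
    qed
  qed
qed

text \<open>The second factor is closed so that the sections over a fixed first coordinate are
  closed and become compact once cut by a ball.\<close>

definition closed_rects :: "'a measure \<Rightarrow> ('a \<times> 'b::topological_space) set set" where
  "closed_rects M = {A \<times> F | A F. A \<in> sets M \<and> closed F}"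

lemma closed_rects_Int:
  "A \<in> closed_rects M \<Longrightarrow> B \<in> closed_rects M \<Longrightarrow> A \<inter> B \<in> closed_rects M"
proof -
  assume "A \<in> closed_rects M" "B \<in> closed_rects M"
  then obtain A1 A2 B1 B2 where *: "A = A1 \<times> A2" "B = B1 \<times> B2" "A1 \<in> sets M" "B1 \<in> sets M" "closed A2" "closed B2"
    by (auto simp: closed_rects_def)
  then have "A \<inter> B = (A1 \<inter> B1) \<times> (A2 \<inter> B2)" by auto
  then show ?thesis using * unfolding closed_rects_def by blast
qed

lemma pair_borel_subset_suslin:
  fixes S :: "('a \<times> 'b::euclidean_space) set"
  assumes "S \<in> sets (M \<Otimes>\<^sub>M borel)"
  shows "S \<in> suslin_sets (closed_rects M)"
proof -
  let ?\<R> = "closed_rects M :: ('a \<times> 'b) set set" and ?\<Omega> = "space M \<times> (UNIV :: 'b set)"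
  have \<Omega>: "?\<Omega> \<in> ?\<R>" by (auto simp: closed_rects_def)
  have sub: "A \<subseteq> ?\<Omega>" if "A \<in> ?\<R>" for A
    using that sets.sets_into_space by (fastforce simp: closed_rects_def)
  have UN: "(\<Union>k. S k) \<in> suslin_sets ?\<R>" if "\<And>k. S k \<in> suslin_sets ?\<R>" for S :: "nat \<Rightarrow> _"
    using suslin_sets_UN[OF that \<Omega> sub] .
  have INT: "(\<Inter>k. S k) \<in> suslin_sets ?\<R>" if "\<And>k. S k \<in> suslin_sets ?\<R>" for S :: "nat \<Rightarrow> _"
    using suslin_sets_INT[OF that closed_rects_Int] .
  have Un: "A \<union> B \<in> suslin_sets ?\<R>" if "A \<in> suslin_sets ?\<R>" "B \<in> suslin_sets ?\<R>" for A B
  proof -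
    have "A \<union> B = (\<Union>k. if k = (0::nat) then A else B)" by (auto split: if_splits)
    also have "\<dots> \<in> suslin_sets ?\<R>" by (intro UN) (use that in auto)
    finally show ?thesis .
  qed
  have "sets (M \<Otimes>\<^sub>M (borel :: 'b measure)) = sigma_sets ?\<Omega> {A \<times> F | A F. A \<in> sets M \<and> F \<in> Collect closed}"
  proof -
    have "sets (M \<Otimes>\<^sub>M (borel :: 'b measure)) = sets (sigma (space M \<times> space borel) {A \<times> F | A F. A \<in> sets M \<and> F \<in> Collect closed})"
    proof (rule sets_pair_eq)
      show "sets M = sigma_sets (space M) (sets M)" by (simp add: sets.sigma_sets_eq)
      show "sets (borel :: 'b measure) = sigma_sets (space borel) (Collect closed)"
        by (simp add: borel_eq_closed)
      show "countable {space M}" "{space M} \<subseteq> sets M" "\<Union> {space M} = space M"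
        "countable {UNIV :: 'b set}" "{UNIV :: 'b set} \<subseteq> Collect closed" "\<Union> {UNIV} = space (borel :: 'b measure)"
        by auto
    qed (use sets.space_closed in auto)
    also have "\<dots> = sigma_sets ?\<Omega> {A \<times> F | A F. A \<in> sets M \<and> F \<in> Collect closed}"
      unfolding space_borel by (rule sets_measure_of) (use sets.sets_into_space in fastforce)
    finally show ?thesis .
  qed
  then have "S \<in> sigma_sets ?\<Omega> ?\<R>"
    using assms by (simp add: closed_rects_def)
  \<comment> \<open>Suslin sets are not closed under complements in general, so the induction
    carries the complement along. In the basic case the complement of a closed factor is open, and
    is written as a countable union of closed boxes.\<close>
  then have "S \<in> suslin_sets ?\<R> \<and> ?\<Omega> - S \<in> suslin_sets ?\<R>"
  proof (induction rule: sigma_sets.induct)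
    case (Basic A)
    then obtain B F where BF: "A = B \<times> F" "B \<in> sets M" "closed F" by (auto simp: closed_rects_def)
    then have eq: "?\<Omega> - A = (space M - B) \<times> UNIV \<union> space M \<times> (-F)"
      using sets.sets_into_space by fastforce
    have "open (-F)" using BF by auto
    from open_countable_Union_open_cbox[OF this] obtain D where D: "countable D" "D \<subseteq> Pow (-F)" "\<And>X. X \<in> D \<Longrightarrow> \<exists>a b. X = cbox a b" "\<Union>D = -F"
      by metis
    have "space M \<times> (-F) \<in> suslin_sets ?\<R>"
    proof (cases "D = {}")
      case True
      then have "space M \<times> (-F) = {} \<times> {}" using D(4) by auto
      also have "\<dots> \<in> ?\<R>" unfolding closed_rects_def by blast
      finally show ?thesis by (rule suslin_sets_basic)
    next
      case False
      with D have D': "range (from_nat_into D) = D" by (intro range_from_nat_into) auto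
      have "space M \<times> (-F) = (\<Union>k. space M \<times> from_nat_into D k)"
        using D(4) D' by blast
      moreover have "space M \<times> from_nat_into D k \<in> ?\<R>" for k
      proof -
        have "from_nat_into D k \<in> D" using D' by blast
        then obtain a b where "from_nat_into D k = cbox a b" using D(3) by blast
        then have "closed (from_nat_into D k)" by (simp add: closed_cbox)
        then show ?thesis unfolding closed_rects_def by blast
      qed
      ultimately show ?thesis using UN suslin_sets_basic by metis
    qed
    moreover have "(space M - B) \<times> UNIV \<in> ?\<R>" using BF by (auto simp: closed_rects_def)
    ultimately show ?case
      unfolding eq using Basic by (intro conjI Un) (auto intro: suslin_sets_basic)
  next
    case Empty
    have "{} \<times> {} \<in> ?\<R>" unfolding closed_rects_def by blast
    then show ?case using \<Omega> by (auto intro: suslin_sets_basic)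
  next
    case (Compl A)
    then have "A \<subseteq> ?\<Omega>" using sigma_sets_into_sp[OF _ Compl(1)] sub by auto
    then show ?case using Compl by (simp add: double_diff)
  next
    case (Union A)
    have "?\<Omega> - (\<Union>i. A i) = (\<Inter>i. ?\<Omega> - A i)" by auto
    then show ?case using Union UN[of A] INT[of "\<lambda>i. ?\<Omega> - A i"] by simp
  qed
  then show ?thesis ..
qed

text \<open>Koenig's lemma for the tree of prefixes bounded by \<open>m\<close>: finite branching
  turns arbitrarily long admissible prefixes into one infinite admissible branch.\<close>

lemma bounded_branch_exists:
  fixes Q :: "nat list \<Rightarrow> bool" and m :: "nat \<Rightarrow> nat"
  assumes anti: "\<And>xs n. Q xs \<Longrightarrow> Q (take n xs)"
    and ex: "\<And>j. \<exists>xs. length xs = j \<and> (\<forall>i<j. xs ! i \<le> m i) \<and> Q xs"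
  shows "\<exists>\<sigma>. (\<forall>i. \<sigma> i \<le> m i) \<and> (\<forall>n. Q (map \<sigma> [0..<n]))"
proof -
  define ext where "ext xs j \<longleftrightarrow> (\<exists>ys. length ys = length xs + j \<and> take (length xs) ys = xs \<and>
    (\<forall>i<length ys. ys ! i \<le> m i) \<and> Q ys)" for xs j
  have ext_mono: "ext xs i" if e: "ext xs j" and "i \<le> j" for xs i j
  proof -
    obtain ys where ys: "length ys = length xs + j" "take (length xs) ys = xs"
      "\<forall>i<length ys. ys ! i \<le> m i" "Q ys" using e unfolding ext_def by blast
    show ?thesis unfolding ext_def
      by (rule exI[where x="take (length xs + i) ys"]) (use ys that(2) anti in auto)
  qed
  have step: "\<exists>k. \<forall>j. ext (xs @ [k]) j" if *: "\<forall>j. ext xs j" for xs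
  proof (rule ccontr)
    assume "\<nexists>k. \<forall>j. ext (xs @ [k]) j"
    then obtain J where J: "\<And>k. \<not> ext (xs @ [k]) (J k)" by metis
    \<comment> \<open>If every child \<open>k\<close> failed at some depth \<open>J k\<close>, then
      the finitely many children allowed by the bound would all fail at the common depth
      \<open>N\<close>. An extension of \<open>xs\<close> by \<open>Suc N\<close> entries
      contradicts this for its own first new entry.\<close>
    define N where "N = Max (J ` {..m (length xs)})"
    have N: "J k \<le> N" if "k \<le> m (length xs)" for k
      using that by (auto simp: N_def)
    obtain ys where ys: "length ys = length xs + Suc N" "take (length xs) ys = xs"
      "\<forall>i<length ys. ys ! i \<le> m i" "Q ys" using * unfolding ext_def by blast
    let ?k = "ys ! length xs"
    have k: "?k \<le> m (length xs)" using ys by auto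
    have "ext (xs @ [?k]) N"
      unfolding ext_def using ys
      by (intro exI[where x=ys]) (auto simp: take_Suc_conv_app_nth)
    then show False using ext_mono[OF _ N[OF k]] J by blast
  qed
  have "\<exists>L. \<forall>n. (length (L n) = n \<and> (\<forall>j. ext (L n) j)) \<and> (\<exists>k. L (Suc n) = L n @ [k])"
  proof (rule dependent_nat_choice)
    have "ext [] j" for j
    proof -
      obtain xs where "length xs = j \<and> (\<forall>i<j. xs ! i \<le> m i) \<and> Q xs" using ex by blast
      then show ?thesis unfolding ext_def by (intro exI[of _ xs]) auto
    qed
    then show "\<exists>x. length x = 0 \<and> (\<forall>j. ext x j)" by (intro exI[of _ "[]"] conjI allI) auto
    fix x n assume x: "length x = n \<and> (\<forall>j. ext x j)"
    then obtain k where "\<forall>j. ext (x @ [k]) j" using step by blast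
    then show "\<exists>y. (length y = Suc n \<and> (\<forall>j. ext y j)) \<and> (\<exists>k. y = x @ [k])"
      using x by (intro exI[of _ "x @ [k]"]) auto
  qed
  then obtain L where L: "\<And>n. length (L n) = n" "\<And>n j. ext (L n) j" "\<And>n. \<exists>k. L (Suc n) = L n @ [k]"
    by blast
  define \<sigma> where "\<sigma> n = L (Suc n) ! n" for n
  have map: "L n = map \<sigma> [0..<n]" for n
  proof (induction n)
    case 0
    then show ?case using L(1)[of 0] by simp
  next
    case (Suc n)
    obtain k where k: "L (Suc n) = L n @ [k]" using L(3) by blast
    then have "\<sigma> n = k" using L(1)[of n] by (simp add: \<sigma>_def nth_append)
    then show ?case using k Suc by simp
  qed
  have "(\<forall>i<n. \<sigma> i \<le> m i) \<and> Q (map \<sigma> [0..<n])" for n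
  proof -
    obtain ys where ys: "length ys = length (L n) + 0" "take (length (L n)) ys = L n"
      "\<forall>i<length ys. ys ! i \<le> m i" "Q ys" using L(2)[of n 0] unfolding ext_def by blast
    then have ys_eq: "ys = map \<sigma> [0..<n]" using map L(1) by auto
    show ?thesis using ys(3,4) unfolding ys_eq by simp
  qed
  then show ?thesis by blast
qed

section \<open>Measurable compact-valued maps and their selections\<close>

text \<open>Hitting sets are tested against closed rather than open sets: closed sublevel sets then
  give argmin maps, and by compactness the condition passes to decreasing intersections of compact
  values.\<close>

definition measurable_compact_valued :: "'a measure \<Rightarrow> ('a \<Rightarrow> 'b::euclidean_space set) \<Rightarrow> bool" where
  "measurable_compact_valued M E \<longleftrightarrow> (\<forall>w\<in>space M. compact (E w)) \<and>
     (\<forall>G. closed G \<longrightarrow> {w \<in> space M. E w \<inter> G \<noteq> {}} \<in> sets M)"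

lemma measurable_compact_valued_argmin:
  fixes E :: "'a \<Rightarrow> 'b::euclidean_space set" and \<phi> :: "'b \<Rightarrow> real"
  assumes E: "measurable_compact_valued M E" and \<phi>: "continuous_on UNIV \<phi>"
  shows "measurable_compact_valued M (\<lambda>w. {y \<in> E w. \<forall>z\<in>E w. \<phi> y \<le> \<phi> z})"
    (is "measurable_compact_valued M ?A")
  unfolding measurable_compact_valued_def
proof (intro conjI ballI allI impI)
  have cl: "closed {y. \<phi> y \<le> a}" for a
    using continuous_closed_vimage[of "{..a}" \<phi>] \<phi>
    by (simp add: vimage_def continuous_on_eq_continuous_at)
  fix w assume "w \<in> space M"
  then have "compact (E w)" using E by (auto simp: measurable_compact_valued_def)
  moreover have "?A w = E w \<inter> (\<Inter>z\<in>E w. {y. \<phi> y \<le> \<phi> z})" by auto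
  ultimately show "compact (?A w)" using cl by (auto intro!: compact_Int_closed)
next
  have cl: "closed {y. \<phi> y \<le> a}" for a
    using continuous_closed_vimage[of "{..a}" \<phi>] \<phi>
    by (simp add: vimage_def continuous_on_eq_continuous_at)
  fix G :: "'b set" assume G: "closed G"
  let ?H = "\<lambda>G. {w \<in> space M. E w \<inter> G \<noteq> {}}"
  have H: "closed G \<Longrightarrow> ?H G \<in> sets M" for G
    using E by (auto simp: measurable_compact_valued_def)
  \<comment> \<open>A minimizer lies in \<open>G\<close> iff the minimum over \<open>E w\<close> is
    already reached on \<open>E w \<inter> G\<close>. This is tested at rational levels
    \<open>q\<close>: whenever \<open>E w\<close> meets the sublevel set at \<open>q\<close>, so
    must \<open>E w \<inter> G\<close>, which leaves a countable intersection.\<close>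
  have "{w \<in> space M. ?A w \<inter> G \<noteq> {}} =
      ?H G \<inter> (\<Inter>q\<in>\<rat>. (space M - ?H {y. \<phi> y \<le> q}) \<union> ?H (G \<inter> {y. \<phi> y \<le> q}))" (is "?L = ?R")
  proof (intro set_eqI iffI)
    fix w assume "w \<in> ?L"
    then obtain y where "w \<in> space M" "y \<in> E w" "y \<in> G" "\<forall>z\<in>E w. \<phi> y \<le> \<phi> z" by auto
    then show "w \<in> ?R" by (auto intro: order_trans)
  next
    fix w assume w: "w \<in> ?R"
    then have wM: "w \<in> space M" and ne: "E w \<inter> G \<noteq> {}" by auto
    have comp: "compact (E w)" using E wM by (auto simp: measurable_compact_valued_def)
    have cont: "continuous_on S \<phi>" for S using \<phi> continuous_on_subset by blast
    obtain y where y: "y \<in> E w \<inter> G" "\<And>z. z \<in> E w \<inter> G \<Longrightarrow> \<phi> y \<le> \<phi> z"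
      using continuous_attains_inf[OF compact_Int_closed[OF comp G] ne cont] by blast
    have "\<phi> y \<le> \<phi> z" if z: "z \<in> E w" for z
    proof (rule ccontr)
      assume "\<not> \<phi> y \<le> \<phi> z"
      then obtain q where q: "q \<in> \<rat>" "\<phi> z < q" "q < \<phi> y" using Rats_dense_in_real[of "\<phi> z" "\<phi> y"] by auto
      have "w \<in> (space M - ?H {y. \<phi> y \<le> q}) \<union> ?H (G \<inter> {y. \<phi> y \<le> q})" using w q(1) by blast
      moreover have "w \<in> ?H {y. \<phi> y \<le> q}" using z q(2) wM by auto
      ultimately obtain y' where "y' \<in> E w" "y' \<in> G" "\<phi> y' \<le> q" by blast
      then show False using y(2)[of y'] q(3) by auto
    qed
    then show "w \<in> ?L" using y(1) wM by auto
  qed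
  also have "?R \<in> sets M"
  proof (intro sets.Int sets.countable_INT' H G)
    show "(\<lambda>q. (space M - ?H {y. \<phi> y \<le> q}) \<union> ?H (G \<inter> {y. \<phi> y \<le> q})) ` \<rat> \<subseteq> sets M"
      using H[OF cl] H[OF closed_Int[OF G cl]] by (auto intro!: sets.Un sets.Diff)
  qed (auto simp: countable_rat)
  finally show "?L \<in> sets M" .
qed

text \<open>The coordinates in \<open>B\<close> are minimized one after the other; each argmin fixes
  one coordinate and keeps those fixed before. With \<open>B = Basis\<close> a single point
  remains.\<close>

lemma measurable_compact_valued_lexmin:
  fixes E :: "'a \<Rightarrow> 'b::euclidean_space set"
  assumes E: "measurable_compact_valued M E" and B: "finite B"
  shows "\<exists>E'. measurable_compact_valued M E' \<and>
    (\<forall>w\<in>space M. E' w \<subseteq> E w \<and> (E w \<noteq> {} \<longrightarrow> E' w \<noteq> {}) \<and> (\<forall>y\<in>E' w. \<forall>z\<in>E' w. \<forall>b\<in>B. y \<bullet> b = z \<bullet> b))"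
  using B
proof (induction B)
  case empty
  then show ?case using E by auto
next
  case (insert b B)
  then obtain E' where E': "measurable_compact_valued M E'"
    "\<And>w. w \<in> space M \<Longrightarrow> E' w \<subseteq> E w \<and> (E w \<noteq> {} \<longrightarrow> E' w \<noteq> {}) \<and> (\<forall>y\<in>E' w. \<forall>z\<in>E' w. \<forall>b\<in>B. y \<bullet> b = z \<bullet> b)"
    by blast
  define A where "A w = {y \<in> E' w. \<forall>z\<in>E' w. y \<bullet> b \<le> z \<bullet> b}" for w
  have "measurable_compact_valued M A"
    unfolding A_def by (rule measurable_compact_valued_argmin[OF E'(1)]) (intro continuous_intros)
  moreover have "A w \<subseteq> E w \<and> (E w \<noteq> {} \<longrightarrow> A w \<noteq> {}) \<and> (\<forall>y\<in>A w. \<forall>z\<in>A w. \<forall>b'\<in>insert b B. y \<bullet> b' = z \<bullet> b')"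
    if w: "w \<in> space M" for w
  proof (intro conjI impI)
    show "A w \<subseteq> E w" using E'(2)[OF w] by (auto simp: A_def)
    show "\<forall>y\<in>A w. \<forall>z\<in>A w. \<forall>b'\<in>insert b B. y \<bullet> b' = z \<bullet> b'"
      using E'(2)[OF w] by (auto simp: A_def intro: antisym)
    assume "E w \<noteq> {}"
    then have "E' w \<noteq> {}" "compact (E' w)"
      using E' w by (auto simp: measurable_compact_valued_def)
    then obtain y where "y \<in> E' w" "\<And>z. z \<in> E' w \<Longrightarrow> y \<bullet> b \<le> z \<bullet> b"
      using continuous_attains_inf[of "E' w" "\<lambda>y. y \<bullet> b"] continuous_on_inner[OF continuous_on_id continuous_on_const]
      by blast
    then show "A w \<noteq> {}" by (auto simp: A_def)
  qed
  ultimately show ?case by blast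
qed

lemma measurable_compact_valued_selection:
  fixes E :: "'a \<Rightarrow> 'b::euclidean_space set"
  assumes E: "measurable_compact_valued M E"
  obtains g where "g \<in> borel_measurable M" "\<And>w. w \<in> space M \<Longrightarrow> E w \<noteq> {} \<Longrightarrow> g w \<in> E w"
proof -
  obtain E' where E': "measurable_compact_valued M E'"
    "\<And>w. w \<in> space M \<Longrightarrow> E' w \<subseteq> E w \<and> (E w \<noteq> {} \<longrightarrow> E' w \<noteq> {}) \<and> (\<forall>y\<in>E' w. \<forall>z\<in>E' w. \<forall>b\<in>Basis. y \<bullet> b = z \<bullet> b)"
    using measurable_compact_valued_lexmin[OF E finite_Basis] by blast
  have single: "y = z" if "w \<in> space M" "y \<in> E' w" "z \<in> E' w" for w y z
  proof (rule euclidean_eqI)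
    show "y \<bullet> b = z \<bullet> b" if "b \<in> Basis" for b
      using E'(2)[OF \<open>w \<in> space M\<close>] \<open>y \<in> E' w\<close> \<open>z \<in> E' w\<close> that by blast
  qed
  \<comment> \<open>The default 0 on empty values makes \<open>g\<close> total; it accounts for the
    extra piece of the preimage when \<open>0 \<in> G\<close>.\<close>
  define g where "g w = (if E' w = {} then 0 else (SOME y. y \<in> E' w))" for w
  have g: "g w \<in> E' w" if "E' w \<noteq> {}" for w
    using that some_in_eq[of "E' w"] by (simp add: g_def)
  show ?thesis
  proof
    show "g \<in> borel_measurable M"
    proof (rule measurableI)
      have H: "closed G \<Longrightarrow> {w \<in> space M. E' w \<inter> G \<noteq> {}} \<in> sets M" for G
        using E' by (auto simp: measurable_compact_valued_def)
      have "g \<in> M \<rightarrow>\<^sub>M sigma UNIV (Collect closed)"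
      proof (rule measurable_measure_of)
        fix G :: "'b set" assume G: "G \<in> Collect closed"
        have "g -` G \<inter> space M = {w \<in> space M. E' w \<inter> G \<noteq> {}} \<union>
          (if 0 \<in> G then space M - {w \<in> space M. E' w \<inter> UNIV \<noteq> {}} else {})"
        proof (intro set_eqI)
          fix w
          show "w \<in> g -` G \<inter> space M \<longleftrightarrow> w \<in> {w \<in> space M. E' w \<inter> G \<noteq> {}} \<union>
            (if 0 \<in> G then space M - {w \<in> space M. E' w \<inter> UNIV \<noteq> {}} else {})"
          proof (cases "E' w = {}")
            case True
            then show ?thesis by (auto simp: g_def)
          next
            case False
            then show ?thesis using g[OF False] single[of w "g w"] by auto
          qed
        qed
        also have "\<dots> \<in> sets M" using H[of G] H[of UNIV] G by auto
        finally show "g -` G \<inter> space M \<in> sets M" .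
      qed auto
      then show "g -` A \<inter> space M \<in> sets M" if "A \<in> sets borel" for A
        using that by (simp add: borel_eq_closed measurable_sets)
    qed auto
    show "g w \<in> E w" if "w \<in> space M" "E w \<noteq> {}" for w
      using E'(2)[OF that(1)] g that by auto
  qed
qed

text \<open>
  Bounding the \<open>i\<close>-th branching of the scheme by a suitable \<open>m i\<close> loses arbitrarily little outer
  measure of the projection, and leaves a finitely branching scheme, which is an intersection of
  finite unions of rectangles.
\<close>

lemma (in finite_measure) suslin_inner_approx:
  fixes S :: "('a \<times> 'b::euclidean_space) set"
  assumes S: "S \<in> suslin_sets (closed_rects M)" and S_proj: "\<And>w. w \<in> space M \<Longrightarrow> \<exists>y. (w, y) \<in> S"
    and t: "t < emeasure M (space M)"
  obtains E where "measurable_compact_valued M E" "\<And>w y. w \<in> space M \<Longrightarrow> y \<in> E w \<Longrightarrow> (w, y) \<in> S"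
    "t \<le> emeasure M {w \<in> space M. E w \<noteq> {}}"
proof -
  obtain R0 where R0': "range R0 \<subseteq> closed_rects M"
    and S0: "S = {z. \<exists>\<sigma>::nat \<Rightarrow> nat. \<forall>n. z \<in> R0 (map \<sigma> [0..<n])}"
    by (rule suslin_setsE[OF S])
  have R0: "R0 xs \<in> closed_rects M" for xs using R0' by auto
  \<comment> \<open>Intersecting over all prefixes makes the scheme decreasing along each branch and
    leaves \<open>S\<close> unchanged.\<close>
  define R where "R xs = (\<Inter>n\<in>{..length xs}. R0 (take n xs))" for xs
  have R: "R xs \<in> closed_rects M" for xs
    unfolding R_def by (rule INT_mem_of_Int_closed) (auto intro: R0 closed_rects_Int)
  have R_anti: "R xs \<subseteq> R (take n xs)" for xs n
    unfolding R_def by (auto simp: min_def)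
  have S: "S = {z. \<exists>\<sigma>. \<forall>n. z \<in> R (map \<sigma> [0..<n])}"
  proof -
    have "(\<forall>n. z \<in> R0 (map \<sigma> [0..<n])) \<longleftrightarrow> (\<forall>n. z \<in> R (map \<sigma> [0..<n]))" for z \<sigma>
    proof
      assume *: "\<forall>n. z \<in> R0 (map \<sigma> [0..<n])"
      show "\<forall>n. z \<in> R (map \<sigma> [0..<n])"
        using * unfolding R_def by (auto simp: take_map)
    next
      assume *: "\<forall>n. z \<in> R (map \<sigma> [0..<n])"
      show "\<forall>n. z \<in> R0 (map \<sigma> [0..<n])"
      proof
        fix n show "z \<in> R0 (map \<sigma> [0..<n])"
          using *[rule_format, of n] unfolding R_def by (auto dest!: bspec[of _ _ n])
      qed
    qed
    then show ?thesis unfolding S0 by simp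
  qed
  \<comment> \<open>These projections are not known to be measurable, but outer measure is
    continuous along increasing sequences of arbitrary subsets. The ball is chosen here once and
    supplies compactness later.\<close>
  define D0 where "D0 N = {w \<in> space M. \<exists>y\<in>cball 0 (real N). (w, y) \<in> S}" for N
  have "(SUP N. outer_measure_of M (D0 N)) = outer_measure_of M (\<Union>N. D0 N)"
    by (intro SUP_outer_measure_of_incseq) (auto simp: D0_def incseq_def intro: order_trans)
  also have "(\<Union>N. D0 N) = space M"
  proof -
    have "\<exists>N. w \<in> D0 N" if w: "w \<in> space M" for w
    proof -
      obtain y where "(w, y) \<in> S" using S_proj[OF w] by blast
      moreover obtain N where "norm y \<le> real N" using real_arch_simple by blast
      ultimately show ?thesis using w by (intro exI[of _ N]) (auto simp: D0_def)
    qed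
    then show ?thesis by (auto simp: D0_def)
  qed
  finally have "t < (SUP N. outer_measure_of M (D0 N))" using t by simp
  then obtain N where N: "t < outer_measure_of M (D0 N)" unfolding less_SUP_iff by blast
  define K where "K = cball (0::'b) (real N)"
  have K: "compact K" by (simp add: K_def)
  \<comment> \<open>Here some branch obeys the bounds \<open>ms\<close> on its first entries, while
    its later entries stay free. As the next bound \<open>k\<close> grows,
    \<open>D (ms @ [k])\<close> increases to \<open>D ms\<close>, so some \<open>k\<close> keeps the
    outer measure above \<open>t\<close>.\<close>
  define D where "D ms = {w \<in> space M. \<exists>y\<in>K. \<exists>\<sigma>. (\<forall>i<length ms. \<sigma> i \<le> ms ! i) \<and> (\<forall>n. (w, y) \<in> R (map \<sigma> [0..<n]))}"
    for ms :: "nat list"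
  have D_step: "\<exists>k. t < outer_measure_of M (D (ms @ [k]))" if "t < outer_measure_of M (D ms)" for ms
  proof -
    have "incseq (\<lambda>k. D (ms @ [k]))"
    proof (rule incseq_SucI, rule subsetI)
      fix k w assume "w \<in> D (ms @ [k])"
      then obtain y \<sigma> where *: "w \<in> space M" "y \<in> K" "\<forall>i<length (ms @ [k]). \<sigma> i \<le> (ms @ [k]) ! i"
        "\<forall>n. (w, y) \<in> R (map \<sigma> [0..<n])" unfolding D_def by blast
      have "\<forall>i<length (ms @ [Suc k]). \<sigma> i \<le> (ms @ [Suc k]) ! i"
        using *(3) by (auto simp: nth_append less_Suc_eq)
      then show "w \<in> D (ms @ [Suc k])" using * unfolding D_def by blast
    qed
    moreover have "(\<Union>k. D (ms @ [k])) = D ms"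
    proof (intro set_eqI iffI)
      fix w assume "w \<in> (\<Union>k. D (ms @ [k]))"
      then obtain k y \<sigma> where "w \<in> space M" "y \<in> K" "\<forall>i<length (ms @ [k]). \<sigma> i \<le> (ms @ [k]) ! i"
        "\<forall>n. (w, y) \<in> R (map \<sigma> [0..<n])" unfolding D_def by blast
      then show "w \<in> D ms" unfolding D_def by (auto simp: nth_append less_Suc_eq)
    next
      fix w assume "w \<in> D ms"
      then obtain y \<sigma> where *: "w \<in> space M" "y \<in> K" "\<forall>i<length ms. \<sigma> i \<le> ms ! i"
        "\<forall>n. (w, y) \<in> R (map \<sigma> [0..<n])" unfolding D_def by blast
      then have "w \<in> D (ms @ [\<sigma> (length ms)])" unfolding D_def
        by (auto simp: nth_append less_Suc_eq)
      then show "w \<in> (\<Union>k. D (ms @ [k]))" by blast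
    qed
    ultimately have "(SUP k. outer_measure_of M (D (ms @ [k]))) = outer_measure_of M (D ms)"
      using SUP_outer_measure_of_incseq[of "\<lambda>k. D (ms @ [k])" M] by (auto simp: D_def)
    then have "t < (SUP k. outer_measure_of M (D (ms @ [k])))" using that by simp
    then show ?thesis unfolding less_SUP_iff by blast
  qed
  have "\<exists>L. \<forall>n. (length (L n) = n \<and> t < outer_measure_of M (D (L n))) \<and> (\<exists>k. L (Suc n) = L n @ [k])"
  proof (rule dependent_nat_choice)
    have "D [] = D0 N" by (auto simp: D_def D0_def S K_def)
    then show "\<exists>ms. length ms = 0 \<and> t < outer_measure_of M (D ms)" using N by auto
    fix ms n assume ms: "length ms = n \<and> t < outer_measure_of M (D ms)"
    then obtain k where "t < outer_measure_of M (D (ms @ [k]))" using D_step by blast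
    then show "\<exists>ms'. (length ms' = Suc n \<and> t < outer_measure_of M (D ms')) \<and> (\<exists>k. ms' = ms @ [k])"
      using ms by (intro exI[of _ "ms @ [k]"]) auto
  qed
  then obtain L where L: "\<And>n. length (L n) = n" "\<And>n. t < outer_measure_of M (D (L n))"
    "\<And>n. \<exists>k. L (Suc n) = L n @ [k]" by blast
  define m where "m n = L (Suc n) ! n" for n
  have Lm: "L n = map m [0..<n]" for n
  proof (induction n)
    case 0
    then show ?case using L(1)[of 0] by simp
  next
    case (Suc n)
    obtain k where k: "L (Suc n) = L n @ [k]" using L(3) by blast
    then have "m n = k" using L(1)[of n] by (simp add: m_def nth_append)
    then show ?case using k Suc by simp
  qed
  define T where "T j = {xs. length xs = j \<and> (\<forall>i<j. xs ! i \<le> m i)}" for j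
  have T_fin: "finite (T j)" for j
  proof (rule finite_subset)
    show "T j \<subseteq> {xs. set xs \<subseteq> {..Max (m ` {..j})} \<and> length xs = j}"
    proof
      fix xs assume xs: "xs \<in> T j"
      have "x \<le> Max (m ` {..j})" if x: "x \<in> set xs" for x
      proof -
        obtain i where i: "i < j" "x = xs ! i" using x xs by (auto simp: T_def in_set_conv_nth)
        then have "x \<le> m i" using xs by (auto simp: T_def)
        also have "\<dots> \<le> Max (m ` {..j})" using i by (intro Max_ge) auto
        finally show ?thesis .
      qed
      then show "xs \<in> {xs. set xs \<subseteq> {..Max (m ` {..j})} \<and> length xs = j}"
        using xs by (auto simp: T_def)
    qed
  qed (simp add: finite_lists_length_eq)
  \<comment> \<open>Only a bounded prefix of length \<open>j\<close> is required here, not a whole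
    branch. This makes \<open>F j w\<close> a finite union of compact sets with measurable hitting
    sets; in the limit \<open>E\<close>, \<open>bounded_branch_exists\<close> recovers a
    branch.\<close>
  define F where "F j w = {y \<in> K. \<exists>xs\<in>T j. (w, y) \<in> R xs}" for j w
  define E where "E w = (\<Inter>j. F j w)" for w
  have F_compact: "compact (F j w)" for j w
  proof -
    have "closed {y. (w, y) \<in> R xs}" for xs
    proof -
      obtain A G where "R xs = A \<times> G" "closed G" using R[of xs] by (auto simp: closed_rects_def)
      then show ?thesis by (cases "w \<in> A") auto
    qed
    moreover have "F j w = K \<inter> (\<Union>xs\<in>T j. {y. (w, y) \<in> R xs})" by (auto simp: F_def)
    ultimately show ?thesis using K T_fin by (auto intro!: compact_Int_closed closed_UN)
  qed
  have F_hit: "{w \<in> space M. F j w \<inter> G \<noteq> {}} \<in> sets M" if "closed G" for j G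
  proof -
    have "{w \<in> space M. \<exists>y\<in>K \<inter> G. (w, y) \<in> R xs} \<in> sets M" for xs
    proof -
      obtain A H where AH: "R xs = A \<times> H" "A \<in> sets M" using R[of xs] by (auto simp: closed_rects_def)
      then have "{w \<in> space M. \<exists>y\<in>K \<inter> G. (w, y) \<in> R xs} = (if K \<inter> G \<inter> H = {} then {} else A)"
        using sets.sets_into_space[OF AH(2)] by auto
      then show ?thesis using AH by auto
    qed
    moreover have "{w \<in> space M. F j w \<inter> G \<noteq> {}} = (\<Union>xs\<in>T j. {w \<in> space M. \<exists>y\<in>K \<inter> G. (w, y) \<in> R xs})"
      by (auto simp: F_def)
    ultimately show ?thesis using T_fin by auto
  qed
  have F_anti: "F j w \<subseteq> F i w" if "i \<le> j" for i j w
  proof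
    fix y assume "y \<in> F j w"
    then obtain xs where xs: "y \<in> K" "xs \<in> T j" "(w, y) \<in> R xs" by (auto simp: F_def)
    then have "take i xs \<in> T i" using that by (auto simp: T_def)
    moreover have "(w, y) \<in> R (take i xs)" using xs R_anti by blast
    ultimately show "y \<in> F i w" using xs(1) by (auto simp: F_def)
  qed
  have E_hit: "{w \<in> space M. E w \<inter> G \<noteq> {}} = (\<Inter>j. {w \<in> space M. F j w \<inter> G \<noteq> {}})" if G: "closed G" for G
  proof (intro set_eqI iffI)
    fix w assume w: "w \<in> (\<Inter>j. {w \<in> space M. F j w \<inter> G \<noteq> {}})"
    \<comment> \<open>Nonempty nested compact sets have a common point, so the hitting set of
      \<open>E\<close> is the intersection of those of the \<open>F j\<close>.\<close>
    have "\<Inter> (range (\<lambda>j. F j w \<inter> G)) \<noteq> {}"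
    proof (rule compact_nest)
      show "compact (F j w \<inter> G)" for j using F_compact G by (intro compact_Int_closed)
    qed (use w F_anti in blast)+
    then show "w \<in> {w \<in> space M. E w \<inter> G \<noteq> {}}" using w by (auto simp: E_def)
  qed (auto simp: E_def)
  show ?thesis
  proof
    show "measurable_compact_valued M E"
      unfolding measurable_compact_valued_def
    proof (intro conjI ballI allI impI)
      show "compact (E w)" for w
      proof -
        have *: "E w = F 0 w \<inter> (\<Inter>j. F j w)" by (auto simp: E_def)
        show ?thesis unfolding *
          by (intro compact_Int_closed closed_INT ballI compact_imp_closed F_compact)
      qed
      show "{w \<in> space M. E w \<inter> G \<noteq> {}} \<in> sets M" if "closed G" for G
        unfolding E_hit[OF that] using F_hit[OF that] by auto
    qed
    show "(w, y) \<in> S" if "w \<in> space M" "y \<in> E w" for w y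
    proof -
      have "\<exists>\<sigma>. (\<forall>i. \<sigma> i \<le> m i) \<and> (\<forall>n. (w, y) \<in> R (map \<sigma> [0..<n]))"
      proof (rule bounded_branch_exists)
        show "(w, y) \<in> R xs \<Longrightarrow> (w, y) \<in> R (take n xs)" for xs n using R_anti by blast
        show "\<exists>xs. length xs = j \<and> (\<forall>i<j. xs ! i \<le> m i) \<and> (w, y) \<in> R xs" for j
          using that by (auto simp: E_def F_def T_def)
      qed
      then show ?thesis unfolding S by blast
    qed
    show "t \<le> emeasure M {w \<in> space M. E w \<noteq> {}}"
    proof -
      have "{w \<in> space M. E w \<noteq> {}} = (\<Inter>j. {w \<in> space M. F j w \<inter> UNIV \<noteq> {}})"
        using E_hit[of UNIV] by simp
      also have "emeasure M \<dots> = (INF j. emeasure M {w \<in> space M. F j w \<inter> UNIV \<noteq> {}})"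
      proof (rule INF_emeasure_decseq[symmetric])
        show "decseq (\<lambda>j. {w \<in> space M. F j w \<inter> UNIV \<noteq> {}})"
        proof (rule decseq_SucI, rule subsetI)
          fix j w assume "w \<in> {w \<in> space M. F (Suc j) w \<inter> UNIV \<noteq> {}}"
          then show "w \<in> {w \<in> space M. F j w \<inter> UNIV \<noteq> {}}" using F_anti[of j "Suc j" w] by auto
        qed
      qed (use F_hit[of UNIV] in auto)
      also have "t \<le> \<dots>"
      proof (rule INF_greatest)
        fix j
        have "D (L j) \<subseteq> {w \<in> space M. F j w \<inter> UNIV \<noteq> {}}"
        proof
          fix w assume "w \<in> D (L j)"
          then obtain y \<sigma> where *: "w \<in> space M" "y \<in> K" "\<forall>i<j. \<sigma> i \<le> m i"
            "\<forall>n. (w, y) \<in> R (map \<sigma> [0..<n])" unfolding D_def by (auto simp: Lm)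
          then have "map \<sigma> [0..<j] \<in> T j" by (auto simp: T_def)
          then have "y \<in> F j w" using * by (auto simp: F_def)
          then show "w \<in> {w \<in> space M. F j w \<inter> UNIV \<noteq> {}}" using * by blast
        qed
        then have "outer_measure_of M (D (L j)) \<le> outer_measure_of M {w \<in> space M. F j w \<inter> UNIV \<noteq> {}}"
          by (rule outer_measure_of_mono)
        also have "\<dots> = emeasure M {w \<in> space M. F j w \<inter> UNIV \<noteq> {}}"
          using F_hit[of UNIV] by (intro outer_measure_of_eq) auto
        finally show "t \<le> emeasure M {w \<in> space M. F j w \<inter> UNIV \<noteq> {}}"
          using L(2)[of j] by auto
      qed
      finally show ?thesis .
    qed
  qed
qed

text \<open>The inner approximations exhaust the space only in measure, which is why a null set is
  left over. Their selections are glued along the least index with a nonempty value.\<close>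

theorem (in finite_measure) measurable_selection_AE:
  fixes S :: "('a \<times> 'b::euclidean_space) set"
  assumes S: "S \<in> sets (M \<Otimes>\<^sub>M borel)" and proj: "\<And>w. w \<in> space M \<Longrightarrow> \<exists>y. (w, y) \<in> S"
  obtains g where "g \<in> borel_measurable M" "AE w in M. (w, g w) \<in> S"
proof (cases "measure M (space M) = 0")
  case True
  then have "AE w in M. (w, 0) \<in> S"
    by (intro AE_I[of _ _ "space M"]) (auto simp: emeasure_eq_measure)
  then show ?thesis by (intro that[of "\<lambda>_. 0"]) auto
next
  case False
  let ?c = "measure M (space M)"
  have c: "0 < ?c" using False measure_nonneg[of M "space M"] by linarith
  \<comment> \<open>Negative differences are truncated to 0 by \<open>ennreal\<close>, and 0 is
    still strictly below the total mass because \<open>?c\<close> is positive.\<close>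
  define t where "t n = ennreal (?c - 1 / real (Suc n))" for n
  have t: "t n < emeasure M (space M)" for n
    unfolding t_def emeasure_eq_measure using c by (intro ennreal_lessI) auto
  have "\<exists>E. measurable_compact_valued M E \<and> (\<forall>w\<in>space M. \<forall>y\<in>E w. (w, y) \<in> S) \<and>
      t n \<le> emeasure M {w \<in> space M. E w \<noteq> {}}" for n
    by (rule suslin_inner_approx[OF pair_borel_subset_suslin[OF S] proj t[of n]]) auto
  then obtain E where E: "\<And>n. measurable_compact_valued M (E n)"
    "\<And>n w y. w \<in> space M \<Longrightarrow> y \<in> E n w \<Longrightarrow> (w, y) \<in> S"
    "\<And>n. t n \<le> emeasure M {w \<in> space M. E n w \<noteq> {}}" by metis
  have "\<exists>g. g \<in> borel_measurable M \<and> (\<forall>w\<in>space M. E n w \<noteq> {} \<longrightarrow> g w \<in> E n w)" for n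
    by (rule measurable_compact_valued_selection[OF E(1)[of n]]) auto
  then obtain g where g: "\<And>n. g n \<in> borel_measurable M"
    "\<And>n w. w \<in> space M \<Longrightarrow> E n w \<noteq> {} \<Longrightarrow> g n w \<in> E n w" by metis
  have meas: "{w \<in> space M. E n w \<noteq> {}} \<in> sets M" for n
    using E(1)[of n] by (auto simp: measurable_compact_valued_def dest!: spec[of _ UNIV])
  define N where "N w = (LEAST n. E n w \<noteq> {})" for w
  have N_meas: "N \<in> M \<rightarrow>\<^sub>M count_space UNIV"
    unfolding N_def using meas by (intro measurable_Least) (auto simp: pred_def)
  let ?U = "\<Union>n. {w \<in> space M. E n w \<noteq> {}}"
  have "?c \<le> measure M ?U"
  proof (rule field_le_epsilon)
    fix e :: real assume e: "0 < e"
    obtain n where n: "1 / real (Suc n) < e"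
      using reals_Archimedean[OF e] by (auto simp: inverse_eq_divide)
    have "t n \<le> emeasure M ?U"
      using E(3)[of n] by (rule order_trans) (intro emeasure_mono, use meas in auto)
    then have "?c - 1 / real (Suc n) \<le> measure M ?U"
      unfolding t_def emeasure_eq_measure by (simp add: ennreal_le_iff)
    then show "?c \<le> measure M ?U + e" using n by simp
  qed
  then have "measure M (space M - ?U) = 0"
    using meas measure_nonneg[of M "space M - ?U"] by (subst finite_measure_compl) (auto simp: finite_measure_compl)
  then have "AE w in M. w \<in> ?U"
    using meas by (intro AE_I[of _ _ "space M - ?U"]) (auto simp: emeasure_eq_measure)
  then have "AE w in M. (w, g (N w) w) \<in> S"
  proof (rule AE_mp, intro AE_I2 impI)
    fix w assume w: "w \<in> space M" "w \<in> ?U"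
    then have "E (N w) w \<noteq> {}" unfolding N_def using LeastI[of "\<lambda>n. E n w \<noteq> {}"] by blast
    then show "(w, g (N w) w) \<in> S" using E(2) g(2) w by blast
  qed
  moreover have "(\<lambda>w. g (N w) w) \<in> borel_measurable M"
    using g(1) N_meas by (rule measurable_compose_countable)
  ultimately show ?thesis by (rule that[rotated])
qed

text \<open>Under the convention \<open>\<infinity> - \<infinity> = \<infinity>\<close>, a strict
  bound on the left difference forces \<open>p'\<close> to be finite, while \<open>q'\<close> may be
  infinite. The additive form stays meaningful in that case and involves only nonnegative measurable
  functions.\<close>

lemma ennreal_add_le_of_ereal_diff_less:
  fixes p q p' q' :: ennreal and v \<eta> :: real
  assumes "enn2ereal p' - enn2ereal q' < enn2ereal p - enn2ereal q - ereal v + ereal \<eta>"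
    and "p < \<top>" "q < \<top>" "0 \<le> v" "0 \<le> \<eta>"
  shows "p' < \<top>" "p' + q + ennreal v \<le> q' + p + ennreal \<eta>"
proof -
  show p': "p' < \<top>"
    using assms by (cases p'; cases q'; cases p; cases q) auto
  show "p' + q + ennreal v \<le> q' + p + ennreal \<eta>"
  proof (cases "q' = \<top>")
    case False
    then show ?thesis
      using assms p' by (cases p'; cases q'; cases p; cases q)
        (auto simp flip: ennreal_plus intro!: ennreal_leI)
  qed simp
qed

section \<open>Conditional and unconditional regret\<close>

locale disintegration = prob_space P
  for P :: "('w \<times> 'c::euclidean_space) measure" +
  fixes M :: "'w measure" and N :: "'c measure" and \<kappa> :: "'w \<Rightarrow> 'c measure"
  assumes space_P: "space P = space M \<times> space N"
    and fst_measurable: "fst \<in> P \<rightarrow>\<^sub>M M" and snd_measurable: "snd \<in> P \<rightarrow>\<^sub>M N"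
    and kernel: "\<kappa> \<in> M \<rightarrow>\<^sub>M prob_algebra N"
    and emeasure_rect: "\<And>A B. A \<in> sets M \<Longrightarrow> B \<in> sets N \<Longrightarrow>
      emeasure P (A \<times> B) = (\<integral>\<^sup>+z. emeasure (\<kappa> (fst z)) B * indicator A (fst z) \<partial>P)"
begin

abbreviation \<mu> :: "'w measure" where "\<mu> \<equiv> distr P M fst"

sublocale marginal: prob_space \<mu>
  by (rule prob_space_distr[OF fst_measurable])

lemma emeasure_marginal_space: "emeasure \<mu> (space M) = 1"
  using marginal.emeasure_space_1 by simp

lemma kernel_subprob: "\<kappa> \<in> M \<rightarrow>\<^sub>M subprob_algebra N"
  by (rule measurable_prob_algebraD[OF kernel])

lemma kernel_prob: "w \<in> space M \<Longrightarrow> prob_space (\<kappa> w)" and kernel_sets: "w \<in> space M \<Longrightarrow> sets (\<kappa> w) = sets N"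
  using measurable_space[OF kernel] by (auto simp: space_prob_algebra)

lemma id_measurable: "(\<lambda>z. z) \<in> P \<rightarrow>\<^sub>M M \<Otimes>\<^sub>M N"
  using measurable_Pair[OF fst_measurable snd_measurable] by simp

lemma kernel_pair_measurable: "(\<lambda>w. distr (\<kappa> w) (M \<Otimes>\<^sub>M N) (Pair w)) \<in> M \<rightarrow>\<^sub>M subprob_algebra (M \<Otimes>\<^sub>M N)"
  by (rule measurable_distr2[OF _ kernel_subprob]) simp

text \<open>The events of \<open>P\<close> may be finer than the product \<sigma>-algebra, as in the
  Lebesgue case, so \<open>P\<close> is first pushed there by the identity. Agreement on rectangles,
  which are closed under intersection, then suffices.\<close>

lemma distr_eq_bind: "distr P (M \<Otimes>\<^sub>M N) (\<lambda>z. z) = \<mu> \<bind> (\<lambda>w. distr (\<kappa> w) (M \<Otimes>\<^sub>M N) (Pair w))"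
  (is "?Q1 = ?Q2")
proof (rule measure_eqI_generator_eq)
  let ?E = "{a \<times> b | a b. a \<in> sets M \<and> b \<in> sets N}" and ?\<Omega> = "space M \<times> space N"
  have ne: "space \<mu> \<noteq> {}" using marginal.not_empty .
  have K: "(\<lambda>w. distr (\<kappa> w) (M \<Otimes>\<^sub>M N) (Pair w)) \<in> \<mu> \<rightarrow>\<^sub>M subprob_algebra (M \<Otimes>\<^sub>M N)"
    using kernel_pair_measurable by simp
  show "Int_stable ?E" by (rule Int_stable_pair_measure_generator)
  show "?E \<subseteq> Pow ?\<Omega>" by (rule pair_measure_closed)
  show "sets ?Q1 = sigma_sets ?\<Omega> ?E" by (simp add: sets_pair_measure)
  show "sets ?Q2 = sigma_sets ?\<Omega> ?E"
    using sets_bind[OF subprob_measurableD(2)[OF K] ne] by (simp add: sets_pair_measure)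
  show "range (\<lambda>_::nat. ?\<Omega>) \<subseteq> ?E" "(\<Union>i::nat. ?\<Omega>) = ?\<Omega>" by auto
  have "emeasure ?Q1 ?\<Omega> = 1"
    using prob_space.emeasure_space_1[OF prob_space_distr[OF id_measurable]] by (simp add: space_pair_measure)
  then show "emeasure ?Q1 ?\<Omega> \<noteq> \<infinity>" by simp
  fix X assume "X \<in> ?E"
  then obtain A B where X: "X = A \<times> B" and A: "A \<in> sets M" and B: "B \<in> sets N" by auto
  have "emeasure ?Q1 X = emeasure P (A \<times> B)"
    using A B sets.sets_into_space[OF A] sets.sets_into_space[OF B]
    by (subst emeasure_distr[OF id_measurable]) (auto simp: X space_P intro!: arg_cong[where f="emeasure P"])
  also have "\<dots> = (\<integral>\<^sup>+z. emeasure (\<kappa> (fst z)) B * indicator A (fst z) \<partial>P)"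
    by (rule emeasure_rect[OF A B])
  also have "\<dots> = (\<integral>\<^sup>+w. emeasure (\<kappa> w) B * indicator A w \<partial>\<mu>)"
  proof (rule nn_integral_distr[OF fst_measurable, symmetric])
    have "(\<lambda>w. emeasure (\<kappa> w) B) \<in> borel_measurable M"
      by (rule measurable_emeasure_kernel[OF kernel_subprob B])
    then show "(\<lambda>w. emeasure (\<kappa> w) B * indicator A w) \<in> borel_measurable \<mu>"
      using A by simp
  qed
  also have "\<dots> = (\<integral>\<^sup>+w. emeasure (distr (\<kappa> w) (M \<Otimes>\<^sub>M N) (Pair w)) X \<partial>\<mu>)"
  proof (rule nn_integral_cong)
    fix w assume "w \<in> space \<mu>"
    then have w: "w \<in> space M" by simp
    have "Pair w \<in> \<kappa> w \<rightarrow>\<^sub>M M \<Otimes>\<^sub>M N"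
      using measurable_Pair1'[OF w] kernel_sets[OF w] by (simp cong: measurable_cong_sets)
    then have "emeasure (distr (\<kappa> w) (M \<Otimes>\<^sub>M N) (Pair w)) X = emeasure (\<kappa> w) (Pair w -` X \<inter> space (\<kappa> w))"
      by (rule emeasure_distr) (use A B X in auto)
    also have "Pair w -` X \<inter> space (\<kappa> w) = (if w \<in> A then B else {})"
      using sets.sets_into_space[OF B] sets_eq_imp_space_eq[OF kernel_sets[OF w]] by (auto simp: X)
    finally show "emeasure (\<kappa> w) B * indicator A w = emeasure (distr (\<kappa> w) (M \<Otimes>\<^sub>M N) (Pair w)) X" by simp
  qed
  also have "\<dots> = emeasure ?Q2 X"
    by (rule emeasure_bind[OF ne K, symmetric]) (use A B X in auto)
  finally show "emeasure ?Q1 X = emeasure ?Q2 X" .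
qed

lemma nn_integral_disintegrate:
  assumes h: "h \<in> borel_measurable (M \<Otimes>\<^sub>M N)"
  shows "(\<integral>\<^sup>+z. h z \<partial>P) = (\<integral>\<^sup>+w. \<integral>\<^sup>+c. h (w, c) \<partial>\<kappa> w \<partial>\<mu>)"
proof -
  have "(\<integral>\<^sup>+z. h z \<partial>P) = (\<integral>\<^sup>+z. h z \<partial>distr P (M \<Otimes>\<^sub>M N) (\<lambda>z. z))"
    using nn_integral_distr[OF id_measurable, of h] h by simp
  also have "\<dots> = (\<integral>\<^sup>+w. \<integral>\<^sup>+z. h z \<partial>distr (\<kappa> w) (M \<Otimes>\<^sub>M N) (Pair w) \<partial>\<mu>)"
    unfolding distr_eq_bind
    by (rule nn_integral_bind[OF h]) (use kernel_pair_measurable in simp)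
  also have "\<dots> = (\<integral>\<^sup>+w. \<integral>\<^sup>+c. h (w, c) \<partial>\<kappa> w \<partial>\<mu>)"
  proof (rule nn_integral_cong)
    fix w assume "w \<in> space \<mu>"
    then have w: "w \<in> space M" by simp
    have "Pair w \<in> \<kappa> w \<rightarrow>\<^sub>M M \<Otimes>\<^sub>M N"
      using measurable_Pair1'[OF w] kernel_sets[OF w] by (simp cong: measurable_cong_sets)
    then show "(\<integral>\<^sup>+z. h z \<partial>distr (\<kappa> w) (M \<Otimes>\<^sub>M N) (Pair w)) = (\<integral>\<^sup>+c. h (w, c) \<partial>\<kappa> w)"
      using h by (intro nn_integral_distr) auto
  qed
  finally show ?thesis .
qed

lemma expect_disintegrate:
  fixes h :: "'w \<Rightarrow> 'c \<Rightarrow> real"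
  assumes h: "(\<lambda>(w, c). h w c) \<in> borel_measurable (M \<Otimes>\<^sub>M N)"
  shows "expect P (\<lambda>(w, c). h w c) =
    enn2ereal (\<integral>\<^sup>+w. \<integral>\<^sup>+c. ennreal (h w c) \<partial>\<kappa> w \<partial>\<mu>) - enn2ereal (\<integral>\<^sup>+w. \<integral>\<^sup>+c. ennreal (- h w c) \<partial>\<kappa> w \<partial>\<mu>)"
proof -
  have "(\<lambda>z. ennreal (case z of (w, c) \<Rightarrow> h w c)) \<in> borel_measurable (M \<Otimes>\<^sub>M N)"
    "(\<lambda>z. ennreal (- (case z of (w, c) \<Rightarrow> h w c))) \<in> borel_measurable (M \<Otimes>\<^sub>M N)"
    using h by measurable
  from this[THEN nn_integral_disintegrate] show ?thesis unfolding expect_def by simp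
qed

lemma kernel_nn_integral_measurable:
  assumes "(\<lambda>(d, c). l d c :: ennreal) \<in> borel_measurable (L \<Otimes>\<^sub>M N)" and g: "g \<in> K \<rightarrow>\<^sub>M L" and u: "u \<in> K \<rightarrow>\<^sub>M M"
  shows "(\<lambda>x. \<integral>\<^sup>+c. l (g x) c \<partial>\<kappa> (u x)) \<in> borel_measurable K"
proof (rule nn_integral_measurable_subprob_algebra2)
  have "(\<lambda>(x, c). (g x, c)) \<in> K \<Otimes>\<^sub>M N \<rightarrow>\<^sub>M L \<Otimes>\<^sub>M N" using g by measurable
  from measurable_compose[OF this assms(1)]
  show "(\<lambda>(x, c). l (g x) c) \<in> borel_measurable (K \<Otimes>\<^sub>M N)" by (simp add: case_prod_beta)
  show "(\<lambda>x. \<kappa> (u x)) \<in> K \<rightarrow>\<^sub>M subprob_algebra N"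
    using measurable_compose[OF u kernel_subprob] .
qed

end

text \<open>
  The near-optimal selection \<open>g'\<close> may have a positive part of infinite expectation, which
  makes its risk \<open>\<infinity>\<close> even where the conditional risks are small. It therefore replaces \<open>g\<close> only on the
  sets \<open>A n\<close> where the positive part is at most \<open>n\<close>. The defining inequality of \<open>S\<close> is stated with
  all terms moved to the additive side, to avoid \<open>\<infinity> - \<infinity>\<close>.
\<close>

lemma (in disintegration) expected_cond_regret_le:
  fixes l :: "'c \<Rightarrow> 'c \<Rightarrow> real"
  assumes l: "(\<lambda>(d, c). l d c) \<in> borel_measurable (borel \<Otimes>\<^sub>M N)"
    and g: "g \<in> borel_measurable M" and v: "v \<in> borel_measurable M"
    and v_nonneg: "\<And>w. w \<in> space M \<Longrightarrow> 0 \<le> v w"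
    and v_le: "\<And>w. w \<in> space M \<Longrightarrow> ereal (v w) \<le> cond_regret l (\<kappa> w) (g w)"
  shows "enn2ereal (\<integral>\<^sup>+w. ennreal (v w) \<partial>\<mu>) \<le> risk l P g - opt_risk (borel_measurable M) l P"
proof -
  define p where "p w d = (\<integral>\<^sup>+c. ennreal (l d c) \<partial>\<kappa> w)" for w d
  define q where "q w d = (\<integral>\<^sup>+c. ennreal (- l d c) \<partial>\<kappa> w)" for w d
  have cond_risk: "cond_risk l (\<kappa> w) d = enn2ereal (p w d) - enn2ereal (q w d)" for w d
    by (simp add: cond_risk_def expect_def p_def q_def)
  have lp: "(\<lambda>(d, c). ennreal (l d c)) \<in> borel_measurable (borel \<Otimes>\<^sub>M N)"
    and lq: "(\<lambda>(d, c). ennreal (- l d c)) \<in> borel_measurable (borel \<Otimes>\<^sub>M N)"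
    using l by (simp_all add: case_prod_beta)
  have p_meas: "(\<lambda>x. p (u x) (h x)) \<in> borel_measurable K"
    and q_meas: "(\<lambda>x. q (u x) (h x)) \<in> borel_measurable K"
    if "h \<in> borel_measurable K" "u \<in> K \<rightarrow>\<^sub>M M" for h u K
    unfolding p_def q_def using that
    by (auto intro!: kernel_nn_integral_measurable[OF lp] kernel_nn_integral_measurable[OF lq])
  have pm: "(\<lambda>w. p w (h w)) \<in> borel_measurable M" and qm: "(\<lambda>w. q w (h w)) \<in> borel_measurable M"
    if "h \<in> borel_measurable M" for h
    using p_meas[OF that, of "\<lambda>w. w"] q_meas[OF that, of "\<lambda>w. w"] by auto
  have risk: "risk l P h = enn2ereal (\<integral>\<^sup>+w. p w (h w) \<partial>\<mu>) - enn2ereal (\<integral>\<^sup>+w. q w (h w) \<partial>\<mu>)"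
    if h: "h \<in> borel_measurable M" for h
  proof -
    have "(\<lambda>(w, c). (h w, c)) \<in> M \<Otimes>\<^sub>M N \<rightarrow>\<^sub>M borel \<Otimes>\<^sub>M N" using h by measurable
    from measurable_compose[OF this l]
    have "(\<lambda>(w, c). l (h w) c) \<in> borel_measurable (M \<Otimes>\<^sub>M N)" by (simp add: case_prod_beta)
    from expect_disintegrate[OF this] show ?thesis unfolding risk_def p_def q_def .
  qed
  define opt where "opt = opt_risk (borel_measurable M) l P"
  have opt_le: "opt \<le> risk l P h" if "h \<in> borel_measurable M" for h
    unfolding opt_def opt_risk_def using that by (rule INF_lower)
  let ?Ip = "\<integral>\<^sup>+w. p w (g w) \<partial>\<mu>" and ?Iq = "\<integral>\<^sup>+w. q w (g w) \<partial>\<mu>"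
  show ?thesis unfolding opt_def[symmetric]
  proof (cases "?Ip < \<top> \<and> ?Iq < \<top> \<and> opt \<noteq> -\<infinity>")
    \<comment> \<open>Each infinite case makes the right-hand side \<infinity>: an infinite positive
      part gives risk \<infinity>; otherwise an infinite negative part gives risk -\<infinity>,
      hence \<open>opt = -\<infinity>\<close>, and subtracting -\<infinity> always yields
      \<infinity>.\<close>
    case False
    then consider "?Ip = \<top>" | "?Ip < \<top>" "?Iq = \<top>" | "opt = -\<infinity>"
      by (auto simp flip: less_top)
    then have "risk l P g - opt = \<infinity>"
    proof cases
      case 1
      then show ?thesis by (simp add: risk[OF g])
    next
      case 2
      then have "risk l P g = -\<infinity>" by (cases ?Ip) (simp_all add: risk[OF g])
      then show ?thesis using opt_le[OF g] by simp
    next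
      case 3
      then show ?thesis by simp
    qed
    then show "enn2ereal (\<integral>\<^sup>+w. ennreal (v w) \<partial>\<mu>) \<le> risk l P g - opt" by simp
  next
    case True
    obtain Ip Iq where Ip: "?Ip = ennreal Ip" "0 \<le> Ip" and Iq: "?Iq = ennreal Iq" "0 \<le> Iq"
      using True by (metis ennreal_cases less_irrefl infinity_ennreal_def)
    have risk_g: "risk l P g = ereal (Ip - Iq)" using risk[OF g] Ip Iq by simp
    then obtain r where r: "opt = ereal r" using True opt_le[OF g] by (cases opt) auto
    have "enn2ereal (\<integral>\<^sup>+w. ennreal (v w) \<partial>\<mu>) \<le> ereal (Ip - Iq - r) + ereal \<eta>" if \<eta>: "0 < \<eta>" for \<eta>
    proof -
      define S where "S = {(w, d) \<in> space (M \<Otimes>\<^sub>M borel). p w (g w) = \<top> \<or> q w (g w) = \<top> \<or>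
        (p w d < \<top> \<and> p w d + q w (g w) + ennreal (v w) \<le> q w d + p w (g w) + ennreal \<eta>)}"
      have S: "S \<in> sets (M \<Otimes>\<^sub>M borel)"
      proof -
        note [measurable] = g v
        have [measurable]: "(\<lambda>x. p (fst x) (g (fst x))) \<in> borel_measurable (M \<Otimes>\<^sub>M borel)"
          "(\<lambda>x. q (fst x) (g (fst x))) \<in> borel_measurable (M \<Otimes>\<^sub>M borel)"
          "(\<lambda>x. p (fst x) (snd x)) \<in> borel_measurable (M \<Otimes>\<^sub>M borel)"
          "(\<lambda>x. q (fst x) (snd x)) \<in> borel_measurable (M \<Otimes>\<^sub>M borel)"
          by (intro p_meas q_meas; measurable)+
        show ?thesis unfolding S_def case_prod_beta prod.collapse by measurable
      qed
      have "\<exists>d. (w, d) \<in> S" if "w \<in> space \<mu>" for w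
      proof (cases "p w (g w) < \<top> \<and> q w (g w) < \<top>")
        case True
        have w: "w \<in> space M" using that by simp
        let ?I = "INF d. cond_risk l (\<kappa> w) d" and ?\<rho> = "enn2ereal (p w (g w)) - enn2ereal (q w (g w))"
        have "?I \<le> ?\<rho>" using INF_lower[of "g w" UNIV "cond_risk l (\<kappa> w)"] cond_risk by simp
        moreover have "ereal (v w) \<le> ?\<rho> - ?I"
          using v_le[OF w] by (simp add: cond_regret_def cond_risk)
        moreover obtain \<rho> where "?\<rho> = ereal \<rho>" using True by (cases "p w (g w)"; cases "q w (g w)") auto
        ultimately have "?I < ?\<rho> - ereal (v w) + ereal \<eta>"
          using \<eta> by (cases ?I) auto
        then obtain d where "cond_risk l (\<kappa> w) d < ?\<rho> - ereal (v w) + ereal \<eta>"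
          unfolding INF_less_iff by blast
        then show ?thesis
          using ennreal_add_le_of_ereal_diff_less[of "p w d" "q w d" "p w (g w)" "q w (g w)" "v w" \<eta>]
            True v_nonneg[OF w] \<eta> w
          by (auto simp: S_def cond_risk space_pair_measure)
      next
        case False
        then show ?thesis using that by (auto simp: S_def space_pair_measure less_top)
      qed
      moreover have "S \<in> sets (\<mu> \<Otimes>\<^sub>M borel)" using S by simp
      ultimately obtain g' where g': "g' \<in> borel_measurable \<mu>" and g'S: "AE w in \<mu>. (w, g' w) \<in> S"
        using marginal.measurable_selection_AE[of S] by metis
      have g'm: "g' \<in> borel_measurable M" using g' by simp
      have fin: "AE w in \<mu>. p w (g w) < \<top>" "AE w in \<mu>. q w (g w) < \<top>"
        using True pm[OF g] qm[OF g] nn_integral_PInf_AE[of "\<lambda>w. p w (g w)" \<mu>] nn_integral_PInf_AE[of "\<lambda>w. q w (g w)" \<mu>]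
        by (auto simp flip: less_top)
      define A where "A n = {w \<in> space M. p w (g' w) \<le> of_nat n}" for n :: nat
      have A: "A n \<in> sets M" for n
        unfolding A_def using pm[OF g'm] by measurable
      have bound: "(\<integral>\<^sup>+w. ennreal (v w) * indicator (A n) w \<partial>\<mu>) \<le> ennreal (Ip - Iq - r + \<eta>)" for n
      proof -
        \<comment> \<open>The positive part of the risk of \<open>h\<close> is at most
          \<open>n + Ip\<close>. As \<open>opt\<close> is finite and bounds the risk of
          \<open>h\<close> from below, its negative part is finite too, so the integrated inequality
          can be rearranged in the reals.\<close>
        define h where "h w = (if w \<in> A n then g' w else g w)" for w
        have h: "h \<in> borel_measurable M"
          unfolding h_def using g g'm A by (intro measurable_If_set) auto
        have "(\<integral>\<^sup>+w. p w (h w) \<partial>\<mu>) \<le> (\<integral>\<^sup>+w. of_nat n + p w (g w) \<partial>\<mu>)"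
          by (intro nn_integral_mono) (auto simp: h_def A_def intro: add_increasing2)
        also have "\<dots> = of_nat n + ennreal Ip"
          using pm[OF g] Ip by (subst nn_integral_add) (auto simp: emeasure_marginal_space)
        also have "\<dots> < \<top>" by (simp add: ennreal_of_nat_eq_real_of_nat)
        finally obtain a where a: "(\<integral>\<^sup>+w. p w (h w) \<partial>\<mu>) = ennreal a" "0 \<le> a"
          by (metis ennreal_cases less_irrefl infinity_ennreal_def)
        have "ereal r \<le> ereal a - enn2ereal (\<integral>\<^sup>+w. q w (h w) \<partial>\<mu>)"
          using opt_le[OF h] a r by (simp add: risk[OF h])
        then obtain b where b: "(\<integral>\<^sup>+w. q w (h w) \<partial>\<mu>) = ennreal b" "0 \<le> b" "r \<le> a - b"
          by (cases "\<integral>\<^sup>+w. q w (h w) \<partial>\<mu>") auto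
        have "(\<integral>\<^sup>+w. p w (h w) + q w (g w) + ennreal (v w) * indicator (A n) w \<partial>\<mu>)
          \<le> (\<integral>\<^sup>+w. q w (h w) + p w (g w) + ennreal \<eta> \<partial>\<mu>)"
          using fin g'S
        proof (intro nn_integral_mono_AE, eventually_elim)
          fix w assume *: "p w (g w) < \<top>" "q w (g w) < \<top>" "(w, g' w) \<in> S"
          show "p w (h w) + q w (g w) + ennreal (v w) * indicator (A n) w
            \<le> q w (h w) + p w (g w) + ennreal \<eta>"
          proof (cases "w \<in> A n")
            case True
            then show ?thesis using * by (auto simp: h_def S_def)
          next
            case False
            then show ?thesis by (simp add: h_def add.commute add_increasing2)
          qed
        qed
        moreover have "(\<integral>\<^sup>+w. p w (h w) + q w (g w) + ennreal (v w) * indicator (A n) w \<partial>\<mu>) =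
            ennreal a + ennreal Iq + (\<integral>\<^sup>+w. ennreal (v w) * indicator (A n) w \<partial>\<mu>)"
          using pm[OF h] qm[OF g] v A a Iq by (simp add: nn_integral_add)
        moreover have "(\<integral>\<^sup>+w. q w (h w) + p w (g w) + ennreal \<eta> \<partial>\<mu>) = ennreal b + ennreal Ip + ennreal \<eta>"
          using pm[OF g] qm[OF h] b Ip emeasure_marginal_space by (simp add: nn_integral_add)
        ultimately have *: "ennreal a + ennreal Iq + (\<integral>\<^sup>+w. ennreal (v w) * indicator (A n) w \<partial>\<mu>)
            \<le> ennreal b + ennreal Ip + ennreal \<eta>" by simp
        show ?thesis
        proof (cases "\<integral>\<^sup>+w. ennreal (v w) * indicator (A n) w \<partial>\<mu>")
          case (real x)
          then have "a + Iq + x \<le> b + Ip + \<eta>"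
            using * a b Ip Iq \<eta> by (simp flip: ennreal_plus)
          then show ?thesis using real b by (auto intro!: ennreal_leI)
        next
          case top
          then show ?thesis using * by (simp flip: ennreal_plus add: top_unique)
        qed
      qed
      \<comment> \<open>By the choice of \<open>S\<close>, \<open>p w (g' w)\<close> is finite
        almost everywhere, so the sets \<open>A n\<close> exhaust almost all of the space and
        monotone convergence removes the truncation.\<close>
      have "(\<integral>\<^sup>+w. ennreal (v w) \<partial>\<mu>) = (\<integral>\<^sup>+w. (SUP n. ennreal (v w) * indicator (A n) w) \<partial>\<mu>)"
        using fin g'S
      proof (intro nn_integral_cong_AE, eventually_elim)
        fix w assume *: "p w (g w) < \<top>" "q w (g w) < \<top>" "(w, g' w) \<in> S"
        then have "p w (g' w) < \<top>" by (auto simp: S_def)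
        then obtain x where x: "p w (g' w) = ennreal x" by (cases "p w (g' w)") auto
        obtain n where "x \<le> real n" using real_arch_simple by blast
        then have "p w (g' w) \<le> of_nat n"
          by (simp add: x ennreal_of_nat_eq_real_of_nat ennreal_leI)
        then have "w \<in> A n" using * by (auto simp: A_def S_def space_pair_measure)
        then have "ennreal (v w) \<le> (SUP n. ennreal (v w) * indicator (A n) w)"
          by (intro SUP_upper2[of n]) auto
        moreover have "(SUP n. ennreal (v w) * indicator (A n) w) \<le> ennreal (v w)"
          by (intro SUP_least) (auto simp: indicator_def)
        ultimately show "ennreal (v w) = (SUP n. ennreal (v w) * indicator (A n) w)" by (rule antisym)
      qed
      also have "\<dots> = (SUP n. \<integral>\<^sup>+w. ennreal (v w) * indicator (A n) w \<partial>\<mu>)"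
      proof (rule nn_integral_monotone_convergence_SUP)
        show "incseq (\<lambda>n w. ennreal (v w) * indicator (A n) w)"
          by (auto simp: incseq_def le_fun_def A_def indicator_def intro: order_trans)
        show "(\<lambda>w. ennreal (v w) * indicator (A n) w) \<in> borel_measurable \<mu>" for n
          using v A by simp
      qed
      also have "\<dots> \<le> ennreal (Ip - Iq - r + \<eta>)" using bound by (rule SUP_least)
      finally have le: "(\<integral>\<^sup>+w. ennreal (v w) \<partial>\<mu>) \<le> ennreal (Ip - Iq - r + \<eta>)" .
      have "0 \<le> Ip - Iq - r + \<eta>" using opt_le[OF g] \<eta> unfolding risk_g r by simp
      then have "enn2ereal (ennreal (Ip - Iq - r + \<eta>)) = ereal (Ip - Iq - r + \<eta>)"
        by (rule enn2ereal_ennreal)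
      then show ?thesis using le unfolding less_eq_ennreal.rep_eq by simp
    qed
    then have "enn2ereal (\<integral>\<^sup>+w. ennreal (v w) \<partial>\<mu>) \<le> ereal (Ip - Iq - r)"
      by (rule ereal_le_epsilon2)
    then show "enn2ereal (\<integral>\<^sup>+w. ennreal (v w) \<partial>\<mu>) \<le> risk l P g - opt"
      by (simp add: risk_g r)
  qed
qed

section \<open>Disintegration of distributions on Lebesgue sets\<close>

text \<open>Passing to the completion in the target requires preimages of null sets to be null; here
  they are cylinders \<open>A \<times> UNIV\<close>, null by the product formula.\<close>

lemma fst_lebesgue_measurable:
  "fst \<in> (lebesgue :: ('a::euclidean_space \<times> 'b::euclidean_space) measure) \<rightarrow>\<^sub>M (lebesgue :: 'a measure)"
proof (rule completion.measurable_completion2)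
  show meas: "fst \<in> (lebesgue :: ('a \<times> 'b) measure) \<rightarrow>\<^sub>M (lborel :: 'a measure)"
    by (rule measurable_completion) (simp add: borel_prod[symmetric])
  show "null_sets (lborel :: 'a measure) \<subseteq> null_sets (distr (lebesgue :: ('a \<times> 'b) measure) lborel fst)"
  proof
    fix A :: "'a set" assume A: "A \<in> null_sets lborel"
    have "emeasure (distr (lebesgue :: ('a \<times> 'b) measure) lborel fst) A = emeasure (lebesgue :: ('a \<times> 'b) measure) (A \<times> UNIV)"
      using A by (subst emeasure_distr[OF meas]) (auto intro!: arg_cong[where f="emeasure lebesgue"])
    also have "\<dots> = emeasure (lborel \<Otimes>\<^sub>M lborel) (A \<times> (UNIV :: 'b set))"
    proof -
      have "A \<in> sets borel" using A by (simp add: null_sets_def)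
      then have "A \<times> (UNIV :: 'b set) \<in> sets lborel" by (auto intro: borel_Times)
      then show ?thesis by (simp add: lborel_prod)
    qed
    also have "\<dots> = 0"
      using A by (subst lborel.emeasure_pair_measure_Times) (auto simp: null_setsD1)
    finally show "A \<in> null_sets (distr (lebesgue :: ('a \<times> 'b) measure) lborel fst)"
      using A by (auto simp: null_sets_def)
  qed
qed

lemma disintegration_of_distribution:
  fixes P :: "('w::euclidean_space \<times> 'c::euclidean_space) measure"
  assumes "distribution_on W C P" and \<kappa>: "cond_distribution W C P \<kappa>"
  shows "disintegration P (lebesgue_on W) (restrict_space borel C) \<kappa>"
proof -
  have prob: "prob_space P" and sets_P: "sets P = sets (lebesgue_on (W \<times> C))"
    using assms by (auto simp: distribution_on_def)
  interpret prob_space P by fact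
  show ?thesis
  proof
    show "space P = space (lebesgue_on W) \<times> space (restrict_space borel C)"
      using sets_eq_imp_space_eq[OF sets_P] by (simp add: space_restrict_space)
    have "fst \<in> lebesgue_on (W \<times> C) \<rightarrow>\<^sub>M lebesgue_on W"
      by (rule measurable_restrict_space3[OF fst_lebesgue_measurable]) auto
    then show "fst \<in> P \<rightarrow>\<^sub>M lebesgue_on W"
      using sets_P by (simp cong: measurable_cong_sets)
    have "snd \<in> (lebesgue :: ('w \<times> 'c) measure) \<rightarrow>\<^sub>M (borel :: 'c measure)"
      by (rule measurable_completion) (simp add: borel_prod[symmetric])
    then have "snd \<in> lebesgue_on (W \<times> C) \<rightarrow>\<^sub>M restrict_space borel C"
      by (rule measurable_restrict_space3) auto
    then show "snd \<in> P \<rightarrow>\<^sub>M restrict_space borel C"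
      using sets_P by (simp cong: measurable_cong_sets)
  qed (use \<kappa> in \<open>auto simp: cond_distribution_def\<close>)
qed

section \<open>The true loss\<close>

locale decision_problem =
  fixes X :: "'c::euclidean_space set" and f :: "'c \<Rightarrow> real" and xs :: "'c \<Rightarrow> 'c"
  assumes X_ne: "X \<noteq> {}" and X_compact: "compact X" and f_cont: "continuous_on X f"
    and xs_sol: "\<And>d. xs d \<in> sol_set X f d"
begin

abbreviation L :: "'c \<Rightarrow> 'c \<Rightarrow> real" where "L \<equiv> true_loss X f xs"

definition opt_val :: "'c \<Rightarrow> real" where "opt_val c = (INF x\<in>X. f x + c \<bullet> x)"

lemma xs_in: "xs d \<in> X" and xs_le: "x \<in> X \<Longrightarrow> f (xs d) + d \<bullet> xs d \<le> f x + d \<bullet> x"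
  using xs_sol[of d] by (auto simp: sol_set_def is_arg_min_linorder)

lemma opt_val_eq: "opt_val c = f (xs c) + c \<bullet> xs c"
  unfolding opt_val_def by (rule cInf_eq_minimum) (auto simp: xs_in xs_le)

lemma true_loss_eq: "L d c = f (xs d) + c \<bullet> xs d - opt_val c"
  by (simp add: true_loss_def opt_val_def)

lemma true_loss_nonneg: "0 \<le> L d c"
  using xs_le[OF xs_in, of c d] by (simp add: true_loss_eq opt_val_eq)

lemma true_loss_self: "L c c = 0"
  by (simp add: true_loss_eq opt_val_eq)

text \<open>A minimum of functions affine in \<open>c\<close> is concave, and a finite concave
  function on the whole space is continuous.\<close>

lemma opt_val_continuous: "continuous_on S opt_val"
proof -
  have "convex_on UNIV (\<lambda>c. - opt_val c)"
  proof (rule convex_onI)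
    fix t :: real and x y :: 'c assume t: "0 < t" "t < 1"
    let ?z = "xs ((1 - t) *\<^sub>R x + t *\<^sub>R y)"
    have "(1 - t) * opt_val x + t * opt_val y \<le> (1 - t) * (f ?z + x \<bullet> ?z) + t * (f ?z + y \<bullet> ?z)"
      unfolding opt_val_eq using t by (intro add_mono mult_left_mono xs_le xs_in) auto
    also have "\<dots> = opt_val ((1 - t) *\<^sub>R x + t *\<^sub>R y)"
      unfolding opt_val_eq by (simp add: inner_add_left algebra_simps)
    finally show "- opt_val ((1 - t) *\<^sub>R x + t *\<^sub>R y) \<le> (1 - t) * - opt_val x + t * - opt_val y"
      by simp
  qed simp
  then have "continuous_on UNIV (\<lambda>c. - opt_val c)"
    by (intro convex_on_continuous) auto
  from continuous_on_minus[OF this] have "continuous_on UNIV opt_val" by simp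
  then show ?thesis using continuous_on_subset by blast
qed

lemma norm_diff_le_B_X: "x \<in> X \<Longrightarrow> x' \<in> X \<Longrightarrow> norm (x - x') \<le> B_X X"
proof -
  assume "x \<in> X" "x' \<in> X"
  have "continuous_on (X \<times> X) (\<lambda>z. norm (fst z - snd z))" by (intro continuous_intros)
  then have "compact ((\<lambda>z. norm (fst z - snd z)) ` (X \<times> X))"
    by (rule compact_continuous_image) (intro compact_Times X_compact)
  then have "bdd_above ((\<lambda>(x, x'). norm (x - x')) ` (X \<times> X))"
    by (simp add: case_prod_beta' compact_imp_bounded bounded_imp_bdd_above)
  then show ?thesis
    unfolding B_X_def using cSUP_upper[of "(x, x')" "X \<times> X" "\<lambda>(x, x'). norm (x - x')"] \<open>x \<in> X\<close> \<open>x' \<in> X\<close> by simp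
qed

lemma f_diff_le_B_f: "x \<in> X \<Longrightarrow> x' \<in> X \<Longrightarrow> f x - f x' \<le> B_f X f"
proof -
  assume "x \<in> X" "x' \<in> X"
  have "continuous_on (X \<times> X) (\<lambda>z. f (fst z) - f (snd z))"
    by (intro continuous_intros continuous_on_compose2[OF f_cont]) auto
  then have "compact ((\<lambda>z. f (fst z) - f (snd z)) ` (X \<times> X))"
    by (rule compact_continuous_image) (intro compact_Times X_compact)
  then have "bdd_above ((\<lambda>(x, x'). f x - f x') ` (X \<times> X))"
    by (simp add: case_prod_beta' compact_imp_bounded bounded_imp_bdd_above)
  then show ?thesis
    unfolding B_f_def using cSUP_upper[of "(x, x')" "X \<times> X" "\<lambda>(x, x'). f x - f x'"] \<open>x \<in> X\<close> \<open>x' \<in> X\<close> by simp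
qed

lemma true_loss_le:
  assumes "norm c \<le> b"
  shows "L d c \<le> B_f X f + b * B_X X"
proof -
  have "L d c = (f (xs d) - f (xs c)) + c \<bullet> (xs d - xs c)"
    by (simp add: true_loss_eq opt_val_eq inner_diff_right)
  also have "\<dots> \<le> B_f X f + norm c * norm (xs d - xs c)"
    by (intro add_mono f_diff_le_B_f xs_in norm_cauchy_schwarz)
  also have "\<dots> \<le> B_f X f + b * B_X X"
    using assms by (intro add_left_mono mult_mono norm_diff_le_B_X xs_in) (auto intro: order_trans[OF norm_ge_zero])
  finally show ?thesis .
qed

text \<open>\<open>f\<close> is continuous only on \<open>X\<close>, so \<open>xs\<close> is viewed
  as a map into the subspace \<open>X\<close>.\<close>

lemma f_xs_measurable:
  assumes "(\<lambda>w. xs (g w)) \<in> borel_measurable M"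
  shows "(\<lambda>w. f (xs (g w))) \<in> borel_measurable M"
proof -
  have "(\<lambda>w. xs (g w)) \<in> M \<rightarrow>\<^sub>M restrict_space borel X"
    using assms by (intro measurable_restrict_space2) (auto simp: xs_in)
  from measurable_compose[OF this borel_measurable_continuous_on_restrict[OF f_cont]] show ?thesis .
qed

end

section \<open>Conditional regret of the true loss for bounded costs\<close>

locale bounded_decision_problem = decision_problem +
  fixes C :: "'a set" and b :: real
  assumes C_bound: "\<And>c. c \<in> C \<Longrightarrow> norm c \<le> b"
begin

definition mean :: "'a measure \<Rightarrow> 'a" where "mean Q = (\<integral>c. c \<partial>Q)"

context
  fixes Q :: "'a measure"
  assumes Q_prob: "prob_space Q" and Q_sets: "sets Q = sets (restrict_space borel C)"
begin

interpretation Q: prob_space Q by (rule Q_prob)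

lemma Q_space: "space Q = C"
  using sets_eq_imp_space_eq[OF Q_sets] by (simp add: space_restrict_space)

lemma Q_measurable: "h \<in> borel_measurable borel \<Longrightarrow> h \<in> borel_measurable Q"
  by (subst measurable_cong_sets[OF Q_sets refl]) (rule measurable_restrict_space1)

lemma Q_integrable_id: "integrable Q (\<lambda>c. c)"
  using C_bound Q_measurable[of "\<lambda>c. c"] by (intro Q.integrable_const_bound[of _ b]) (auto simp: Q_space)

lemma Q_integrable_opt_val: "integrable Q opt_val"
proof -
  have "compact (opt_val ` cball 0 b)"
    by (intro compact_continuous_image opt_val_continuous compact_cball)
  from compact_imp_bounded[OF this] obtain B where "\<forall>x\<in>opt_val ` cball 0 b. norm x \<le> B"
    unfolding bounded_iff by blast
  then have "norm (opt_val c) \<le> B" if "c \<in> C" for c using C_bound[OF that] by simp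
  then show ?thesis
    by (intro Q.integrable_const_bound[of _ B] Q_measurable borel_measurable_continuous_onI opt_val_continuous)
      (rule AE_I2, simp add: Q_space)
qed

lemma norm_mean_le: "norm (mean Q) \<le> b"
proof -
  have "norm (mean Q) \<le> (\<integral>c. norm c \<partial>Q)"
    unfolding mean_def by (rule integral_norm_bound)
  also have "\<dots> \<le> (\<integral>c. b \<partial>Q)"
    using Q_integrable_id C_bound by (intro integral_mono) (auto simp: Q_space)
  finally show ?thesis by (simp add: Q.prob_space)
qed

lemma true_loss_integrable: "integrable Q (L d)"
  unfolding true_loss_eq[abs_def] using Q_integrable_id Q_integrable_opt_val by simp

text \<open>Integrating the part affine in \<open>c\<close> only sees \<open>mean Q\<close>. The
  remainder does not depend on \<open>d\<close>, and \<open>L (mean Q) (mean Q) = 0\<close>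
  identifies it as the risk of the decision \<open>mean Q\<close>, which is thereby minimal.\<close>

lemma integral_true_loss: "(\<integral>c. L d c \<partial>Q) = L d (mean Q) + (\<integral>c. L (mean Q) c \<partial>Q)"
  unfolding true_loss_eq mean_def
  using Q_integrable_id Q_integrable_opt_val opt_val_eq[of "\<integral>c. c \<partial>Q"] by (simp add: Q.prob_space)

lemma cond_regret_true_loss: "cond_regret L Q d = ereal (L d (mean Q))"
proof -
  have risk: "cond_risk L Q d = ereal (L d (mean Q) + (\<integral>c. L (mean Q) c \<partial>Q))" for d
    unfolding cond_risk_def expect_eq_integral[OF true_loss_integrable] integral_true_loss[of d] ..
  have "(INF d. cond_risk L Q d) = ereal (\<integral>c. L (mean Q) c \<partial>Q)"
  proof (rule antisym)
    show "(INF d. cond_risk L Q d) \<le> ereal (\<integral>c. L (mean Q) c \<partial>Q)"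
      by (rule INF_lower2[of "mean Q"]) (auto simp: risk true_loss_self)
    show "ereal (\<integral>c. L (mean Q) c \<partial>Q) \<le> (INF d. cond_risk L Q d)"
      by (rule INF_greatest) (simp add: risk true_loss_nonneg)
  qed
  then show ?thesis by (simp add: cond_regret_def risk)
qed

lemma integral_true_loss_le: "(\<integral>c. L d c \<partial>Q) \<le> B_f X f + b * B_X X"
proof -
  have "(\<integral>c. L d c \<partial>Q) \<le> (\<integral>c. B_f X f + b * B_X X \<partial>Q)"
    using true_loss_integrable C_bound by (intro integral_mono true_loss_le) (auto simp: Q_space)
  then show ?thesis by (simp add: Q.prob_space)
qed

end

end

lemma (in disintegration) kernel_integral_measurable:
  fixes u :: "'c \<Rightarrow> 'b::{banach, second_countable_topology}"
  assumes "u \<in> borel_measurable N"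
  shows "(\<lambda>w. \<integral>c. u c \<partial>\<kappa> w) \<in> borel_measurable M"
  using measurable_compose[OF kernel_subprob integral_measurable_subprob_algebra[OF assms]] .

section \<open>True risk and regret under one distribution\<close>

locale distribution_problem =
  bounded_decision_problem X f xs C b + disintegration P "lebesgue_on W" "restrict_space borel C" \<kappa>
  for X :: "'c::euclidean_space set" and f xs C b and P :: "('w::euclidean_space \<times> 'c) measure" and W \<kappa>
begin

definition post_mean :: "'w \<Rightarrow> 'c" where "post_mean w = mean (\<kappa> w)"

lemma kernel_cond: "w \<in> W \<Longrightarrow> prob_space (\<kappa> w)" "w \<in> W \<Longrightarrow> sets (\<kappa> w) = sets (restrict_space borel C)"
  using kernel_prob kernel_sets by (auto simp: space_restrict_space)

lemma post_mean_measurable: "post_mean \<in> borel_measurable (lebesgue_on W)"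
  unfolding post_mean_def mean_def
  by (rule kernel_integral_measurable) (auto intro: measurable_restrict_space1)

lemma regret_measurable:
  assumes "g \<in> true_predictors W xs"
  shows "(\<lambda>w. L (g w) (post_mean w)) \<in> borel_measurable (lebesgue_on W)"
proof -
  have xs: "(\<lambda>w. xs (g w)) \<in> borel_measurable (lebesgue_on W)"
    using assms by (simp add: true_predictors_def)
  have "opt_val \<in> borel_measurable borel"
    by (intro borel_measurable_continuous_onI opt_val_continuous)
  then show ?thesis
    unfolding true_loss_eq using xs f_xs_measurable[OF xs] post_mean_measurable
    by (intro borel_measurable_diff borel_measurable_add borel_measurable_inner
        measurable_compose[OF post_mean_measurable]) auto
qed

lemma minimal_risk_measurable:
  "(\<lambda>w. \<integral>c. L (post_mean w) c \<partial>\<kappa> w) \<in> borel_measurable (lebesgue_on W)"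
proof -
  have V: "opt_val \<in> borel_measurable borel"
    by (intro borel_measurable_continuous_onI opt_val_continuous)
  have "(\<lambda>w. opt_val (post_mean w) - (\<integral>c. opt_val c \<partial>\<kappa> w)) \<in> borel_measurable (lebesgue_on W)"
    using V by (intro borel_measurable_diff measurable_compose[OF post_mean_measurable]
        kernel_integral_measurable measurable_restrict_space1) auto
  moreover have "(\<integral>c. L (post_mean w) c \<partial>\<kappa> w) = opt_val (post_mean w) - (\<integral>c. opt_val c \<partial>\<kappa> w)"
    if "w \<in> W" for w
  proof -
    interpret K: prob_space "\<kappa> w" using kernel_cond that by auto
    show ?thesis
      using Q_integrable_id[OF kernel_cond[OF that]] Q_integrable_opt_val[OF kernel_cond[OF that]]
        opt_val_eq[of "\<integral>c. c \<partial>\<kappa> w"]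
      unfolding true_loss_eq by (simp add: K.prob_space post_mean_def mean_def)
  qed
  ultimately show ?thesis
    by (subst measurable_cong) (auto simp: space_restrict_space)
qed

text \<open>The second summand is independent of \<open>g\<close>: it is the mean of the minimal
  conditional risks and cancels in the regret.\<close>

lemma risk_true_loss:
  assumes g: "g \<in> true_predictors W xs"
  shows "risk L P g = enn2ereal ((\<integral>\<^sup>+w. ennreal (L (g w) (post_mean w)) \<partial>\<mu>) +
    (\<integral>\<^sup>+w. ennreal (\<integral>c. L (post_mean w) c \<partial>\<kappa> w) \<partial>\<mu>))"
proof -
  have xs: "(\<lambda>w. xs (g w)) \<in> borel_measurable (lebesgue_on W)"
    using g by (simp add: true_predictors_def)
  note [measurable] = xs f_xs_measurable[OF xs]
  have [measurable]: "opt_val \<in> borel_measurable borel"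
    by (intro borel_measurable_continuous_onI opt_val_continuous)
  have id: "(\<lambda>c. c) \<in> restrict_space borel C \<rightarrow>\<^sub>M borel" by (rule measurable_restrict_space1) simp
  have [measurable]: "snd \<in> lebesgue_on W \<Otimes>\<^sub>M restrict_space borel C \<rightarrow>\<^sub>M borel"
    by (rule measurable_compose[OF measurable_snd id])
  have "(\<lambda>(w, c). L (g w) c) \<in> borel_measurable (lebesgue_on W \<Otimes>\<^sub>M restrict_space borel C)"
    unfolding true_loss_eq case_prod_beta by measurable
  from expect_disintegrate[OF this]
  have "risk L P g = enn2ereal (\<integral>\<^sup>+w. \<integral>\<^sup>+c. ennreal (L (g w) c) \<partial>\<kappa> w \<partial>\<mu>)"
    by (simp add: risk_def ennreal_neg true_loss_nonneg zero_ennreal.rep_eq)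
  also have "(\<integral>\<^sup>+w. \<integral>\<^sup>+c. ennreal (L (g w) c) \<partial>\<kappa> w \<partial>\<mu>) =
      (\<integral>\<^sup>+w. ennreal (L (g w) (post_mean w)) + ennreal (\<integral>c. L (post_mean w) c \<partial>\<kappa> w) \<partial>\<mu>)"
  proof (rule nn_integral_cong)
    fix w assume "w \<in> space \<mu>"
    then have w: "w \<in> W" by (simp add: space_restrict_space)
    have "(\<integral>\<^sup>+c. ennreal (L (g w) c) \<partial>\<kappa> w) = ennreal (\<integral>c. L (g w) c \<partial>\<kappa> w)"
      by (intro nn_integral_eq_integral true_loss_integrable kernel_cond[OF w]) (auto simp: true_loss_nonneg)
    also have "\<dots> = ennreal (L (g w) (post_mean w)) + ennreal (\<integral>c. L (post_mean w) c \<partial>\<kappa> w)"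
      unfolding integral_true_loss[OF kernel_cond[OF w], of "g w"] post_mean_def
      by (intro ennreal_plus true_loss_nonneg integral_nonneg_AE) (auto simp: true_loss_nonneg)
    finally show "(\<integral>\<^sup>+c. ennreal (L (g w) c) \<partial>\<kappa> w) =
      ennreal (L (g w) (post_mean w)) + ennreal (\<integral>c. L (post_mean w) c \<partial>\<kappa> w)" .
  qed
  also have "\<dots> = (\<integral>\<^sup>+w. ennreal (L (g w) (post_mean w)) \<partial>\<mu>) +
    (\<integral>\<^sup>+w. ennreal (\<integral>c. L (post_mean w) c \<partial>\<kappa> w) \<partial>\<mu>)"
    using regret_measurable[OF g] minimal_risk_measurable by (intro nn_integral_add) auto
  finally show ?thesis .
qed

lemma regret_bounds:
  assumes "w \<in> W"
  shows "0 \<le> L (g w) (post_mean w)" "L (g w) (post_mean w) \<le> B_f X f + b * B_X X"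
  using norm_mean_le[OF kernel_cond[OF assms]] true_loss_le true_loss_nonneg by (auto simp: post_mean_def)

lemma regret_integrable:
  assumes "g \<in> true_predictors W xs"
  shows "integrable \<mu> (\<lambda>w. L (g w) (post_mean w))"
  using regret_measurable[OF assms] regret_bounds
  by (intro marginal.integrable_const_bound[of _ "B_f X f + b * B_X X"]) (auto simp: space_restrict_space)

text \<open>
  The upper bound may be strict: the pointwise minimizer \<open>post_mean\<close> need not be in
  \<open>true_predictors W xs\<close>.
\<close>

lemma true_regret_le:
  assumes g: "g \<in> true_predictors W xs"
  defines "t \<equiv> real_of_ereal (risk L P g - opt_risk (true_predictors W xs) L P)"
  shows "0 \<le> t" "t \<le> (\<integral>w. L (g w) (post_mean w) \<partial>\<mu>)"
proof -
  let ?J = "\<integral>\<^sup>+w. ennreal (\<integral>c. L (post_mean w) c \<partial>\<kappa> w) \<partial>\<mu>"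
  let ?T = "\<integral>w. L (g w) (post_mean w) \<partial>\<mu>"
  have T: "(\<integral>\<^sup>+w. ennreal (L (g w) (post_mean w)) \<partial>\<mu>) = ennreal ?T"
    using regret_bounds by (intro nn_integral_eq_integral regret_integrable[OF g]) (auto simp: space_restrict_space)
  have T0: "0 \<le> ?T" using regret_bounds by (intro integral_nonneg_AE) (auto simp: space_restrict_space)
  have "?J \<le> (\<integral>\<^sup>+w. ennreal (B_f X f + b * B_X X) \<partial>\<mu>)"
    using kernel_cond by (intro nn_integral_mono ennreal_leI integral_true_loss_le) (auto simp: space_restrict_space)
  also have "\<dots> < \<top>" using emeasure_marginal_space by (simp add: ennreal_mult_less_top)
  finally obtain J where J: "?J = ennreal J" "0 \<le> J" by (cases ?J) auto
  have risk_g: "risk L P g = ereal (?T + J)"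
    using J T T0 by (simp add: risk_true_loss[OF g] flip: ennreal_plus)
  have "ereal J \<le> opt_risk (true_predictors W xs) L P"
    unfolding opt_risk_def
  proof (rule INF_greatest)
    fix h assume h: "h \<in> true_predictors W xs"
    have "enn2ereal (ennreal J) \<le> risk L P h"
      unfolding risk_true_loss[OF h] J less_eq_ennreal.rep_eq[symmetric] by simp
    then show "ereal J \<le> risk L P h" using J by simp
  qed
  moreover have "opt_risk (true_predictors W xs) L P \<le> ereal (?T + J)"
    unfolding opt_risk_def risk_g[symmetric] by (rule INF_lower[OF g])
  ultimately obtain r where "opt_risk (true_predictors W xs) L P = ereal r" "J \<le> r" "r \<le> ?T + J"
    by (cases "opt_risk (true_predictors W xs) L P") auto
  then show "0 \<le> t" "t \<le> ?T" by (auto simp: t_def risk_g)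
qed

end

section \<open>The calibration envelope\<close>

text \<open>This holds for infinite values as well, since equal infinities subtract to \<infinity>
  on \<open>ereal\<close>.\<close>

lemma cond_regret_nonneg: "0 \<le> cond_regret loss Q d"
proof -
  have "(INF d'. cond_risk loss Q d') \<le> cond_risk loss Q d" by (rule INF_lower) simp
  then show ?thesis
    unfolding cond_regret_def
    by (cases "cond_risk loss Q d"; cases "INF d'. cond_risk loss Q d'") auto
qed

lemma calibration_fun_nonneg: "0 \<le> calibration_fun W \<kappa> \<P> L l \<epsilon>"
  unfolding calibration_fun_def by (rule Inf_greatest) (auto simp: cond_regret_nonneg)

lemma calibration_fun_le:
  "w \<in> W \<Longrightarrow> P \<in> \<P> \<Longrightarrow> ereal \<epsilon> \<le> cond_regret L (\<kappa> P w) d \<Longrightarrow>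
    calibration_fun W \<kappa> \<P> L l \<epsilon> \<le> cond_regret l (\<kappa> P w) d"
  unfolding calibration_fun_def by (rule Inf_lower) blast

lemma calibration_fun_mono: "\<epsilon> \<le> \<epsilon>' \<Longrightarrow> calibration_fun W \<kappa> \<P> L l \<epsilon> \<le> calibration_fun W \<kappa> \<P> L l \<epsilon>'"
  unfolding calibration_fun_def
proof (rule Inf_superset_mono, rule subsetI)
  fix x assume "\<epsilon> \<le> \<epsilon>'" and
    "x \<in> {cond_regret l (\<kappa> P w) d |d w P. w \<in> W \<and> P \<in> \<P> \<and> ereal \<epsilon>' \<le> cond_regret L (\<kappa> P w) d}"
  moreover have "ereal \<epsilon> \<le> ereal \<epsilon>'" using \<open>\<epsilon> \<le> \<epsilon>'\<close> by simp
  ultimately show "x \<in> {cond_regret l (\<kappa> P w) d |d w P. w \<in> W \<and> P \<in> \<P> \<and> ereal \<epsilon> \<le> cond_regret L (\<kappa> P w) d}"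
    using order_trans by blast
qed

lemma calibration_fun_pos:
  assumes "uniformly_calibrated W \<kappa> \<P> L l" and "0 < \<epsilon>"
  shows "0 < calibration_fun W \<kappa> \<P> L l \<epsilon>"
proof -
  obtain \<delta> where \<delta>: "0 < \<delta>" "\<And>P w d. P \<in> \<P> \<Longrightarrow> w \<in> W \<Longrightarrow>
      cond_regret l (\<kappa> P w) d < ereal \<delta> \<Longrightarrow> cond_regret L (\<kappa> P w) d < ereal \<epsilon>"
    using assms(1)[unfolded uniformly_calibrated_def, rule_format, OF assms(2)] by blast
  have "ereal \<delta> \<le> calibration_fun W \<kappa> \<P> L l \<epsilon>"
    unfolding calibration_fun_def
  proof (rule Inf_greatest)
    fix x assume "x \<in> {cond_regret l (\<kappa> P w) d |d w P. w \<in> W \<and> P \<in> \<P> \<and> ereal \<epsilon> \<le> cond_regret L (\<kappa> P w) d}"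
    then obtain d w P where x: "x = cond_regret l (\<kappa> P w) d" and "w \<in> W" "P \<in> \<P>"
      and "ereal \<epsilon> \<le> cond_regret L (\<kappa> P w) d" by blast
    then show "ereal \<delta> \<le> x" using \<delta>(2)[of P w d] by (metis not_less)
  qed
  then show ?thesis using \<delta>(1) by (metis ereal_less(2) less_le_trans)
qed

lemma convex_on_max_0: "convex_on S h \<Longrightarrow> convex_on S (\<lambda>x. max 0 (h x) :: real)"
proof (rule convex_onI)
  assume h: "convex_on S h"
  then show "convex S" by (rule convex_on_imp_convex)
  fix t x y assume *: "0 < t" "t < (1::real)" "x \<in> S" "y \<in> S"
  have "h ((1 - t) *\<^sub>R x + t *\<^sub>R y) \<le> (1 - t) * h x + t * h y"
    using convex_onD[OF h, of t x y] * by simp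
  also have "\<dots> \<le> (1 - t) * max 0 (h x) + t * max 0 (h y)"
    using * by (intro add_mono mult_left_mono) auto
  finally show "max 0 (h ((1 - t) *\<^sub>R x + t *\<^sub>R y)) \<le> (1 - t) * max 0 (h x) + t * max 0 (h y)"
    using * by simp
qed

lemma convex_envelope_pos:
  assumes nonneg: "\<And>t. 0 \<le> u t" and mono: "\<And>s t. s \<le> t \<Longrightarrow> u s \<le> u t"
    and pos: "\<And>t. 0 < t \<Longrightarrow> 0 < u t" and "0 < \<epsilon>" "\<epsilon> \<le> B" and I: "\<And>t. t \<in> I \<Longrightarrow> t \<le> B"
  shows "0 < convex_envelope I u \<epsilon>"
proof -
  obtain \<delta> where \<delta>: "0 < \<delta>" "ereal \<delta> \<le> u (\<epsilon> / 2)"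
  proof -
    have "0 < u (\<epsilon> / 2)" using pos \<open>0 < \<epsilon>\<close> by simp
    then obtain z where "0 < ereal z" "ereal z < u (\<epsilon> / 2)" using ereal_dense2 by blast
    then show ?thesis by (intro that[of z]) auto
  qed
  have B: "0 < B - \<epsilon> / 2" using assms by simp
  define a where "a = \<delta> / (B - \<epsilon> / 2)"
  have a: "0 < a" "a * (B - \<epsilon> / 2) = \<delta>" using \<delta> B by (auto simp: a_def)
  define h where "h t = max 0 (a * (t - \<epsilon> / 2))" for t
    \<comment> \<open>zero up to \<open>\<epsilon> / 2\<close>, then rising linearly to at most \<open>\<delta> \<le> u (\<epsilon> / 2)\<close> on \<open>I\<close>\<close>
  have "convex_on UNIV (\<lambda>t. a * (t - \<epsilon> / 2))"
    by (rule convex_onI) (auto simp: field_simps)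
  then have "convex_on UNIV h" unfolding h_def by (rule convex_on_max_0)
  moreover have "ereal (h t) \<le> u t" if "t \<in> I" for t
  proof (cases "t \<le> \<epsilon> / 2")
    case True
    then have "h t = 0" using a by (simp add: h_def mult_nonneg_nonpos)
    then show ?thesis using nonneg[of t] by (simp add: zero_ereal_def[symmetric])
  next
    case False
    have "h t \<le> a * (B - \<epsilon> / 2)"
      using False I[OF that] a(1) by (auto simp: h_def intro!: mult_left_mono)
    then have "ereal (h t) \<le> ereal \<delta>" using a by simp
    also have "\<dots> \<le> u (\<epsilon> / 2)" by (rule \<delta>)
    also have "\<dots> \<le> u t" using False by (intro mono) simp
    finally show ?thesis .
  qed
  ultimately have "ereal (h \<epsilon>) \<le> convex_envelope I u \<epsilon>"
    unfolding convex_envelope_def by (intro SUP_upper) auto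
  moreover have "0 < h \<epsilon>" using a \<open>0 < \<epsilon>\<close> by (simp add: h_def)
  ultimately show ?thesis by (metis ereal_less(2) less_le_trans)
qed

text \<open>At level 0 every \<open>d\<close> competes because true regrets are nonnegative. A
  finite infimum provides decisions of arbitrarily small surrogate regret; an infinite one would
  make all regrets \<infinity>.\<close>

lemma calibration_fun_0:
  assumes "w \<in> W" "P \<in> \<P>" and fin: "\<bar>INF d. cond_risk l (\<kappa> P w) d\<bar> \<noteq> \<infinity>"
  shows "calibration_fun W \<kappa> \<P> L l 0 \<le> 0"
proof (rule ereal_le_epsilon2)
  fix e :: real assume e: "0 < e"
  obtain r where r: "(INF d. cond_risk l (\<kappa> P w) d) = ereal r" using fin by auto
  then have "(INF d. cond_risk l (\<kappa> P w) d) < ereal (r + e)" using e by simp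
  then obtain d where "cond_risk l (\<kappa> P w) d < ereal (r + e)" unfolding INF_less_iff by blast
  then have "cond_regret l (\<kappa> P w) d \<le> ereal e"
    unfolding cond_regret_def r by (cases "cond_risk l (\<kappa> P w) d") auto
  moreover have "calibration_fun W \<kappa> \<P> L l 0 \<le> cond_regret l (\<kappa> P w) d"
    using assms cond_regret_nonneg[of L "\<kappa> P w" d] by (intro calibration_fun_le) (auto simp: zero_ereal_def)
  ultimately show "calibration_fun W \<kappa> \<P> L l 0 \<le> 0 + ereal e" by auto
qed

text \<open>The point \<open>t\<close> lies on the segment from 0 to \<open>T\<close>, so the graph
  is below the chord from the origin, which is increasing as \<open>h T\<close> is
  nonnegative.\<close>

lemma convex_nonneg_le_at_larger:
  fixes h :: "real \<Rightarrow> real"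
  assumes h: "convex_on UNIV h" "\<And>x. 0 \<le> h x" "h 0 = 0" and t: "0 \<le> t" "t \<le> T"
  shows "h t \<le> h T"
proof (cases "T = 0")
  case False
  then have "h ((1 - t / T) *\<^sub>R 0 + (t / T) *\<^sub>R T) \<le> (1 - t / T) * h 0 + (t / T) * h T"
    using t by (intro convex_onD[OF h(1)]) auto
  then have "h t \<le> (t / T) * h T" using False h(3) by simp
  also have "\<dots> \<le> 1 * h T" using t False h(2) by (intro mult_right_mono) auto
  finally show ?thesis by simp
qed (use t in auto)

lemma (in distribution_problem) envelope_le_surrogate_regret:
  fixes \<K> :: "('w \<times> 'c) measure \<Rightarrow> 'w \<Rightarrow> 'c measure"
  assumes \<K>: "\<K> P = \<kappa>" and P: "P \<in> \<P>"
    and l: "(\<lambda>(d, c). l d c) \<in> borel_measurable borel"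
    and g: "g \<in> true_predictors W xs"
    and I: "{0..B_f X f + b * B_X X} \<subseteq> I"
  shows "convex_envelope I (calibration_fun W \<K> \<P> L l)
      (real_of_ereal (risk L P g - opt_risk (true_predictors W xs) L P))
    \<le> risk l P g - opt_risk (predictors W) l P"
proof -
  let ?t = "real_of_ereal (risk L P g - opt_risk (true_predictors W xs) L P)"
  let ?B = "B_f X f + b * B_X X"
  let ?r = "\<lambda>w. L (g w) (post_mean w)"
  let ?T = "\<integral>w. ?r w \<partial>\<mu>"
  let ?\<delta> = "calibration_fun W \<K> \<P> L l"
  have g': "g \<in> borel_measurable (lebesgue_on W)" using g by (simp add: true_predictors_def predictors_def)
  have l': "(\<lambda>(d, c). l d c) \<in> borel_measurable (borel \<Otimes>\<^sub>M restrict_space borel C)"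
  proof -
    have "(\<lambda>z. z) \<in> borel \<Otimes>\<^sub>M restrict_space borel C \<rightarrow>\<^sub>M (borel \<Otimes>\<^sub>M borel :: ('c \<times> 'c) measure)"
      using measurable_Pair[OF measurable_fst measurable_compose[OF measurable_snd measurable_restrict_space1[OF measurable_ident]]]
      by simp
    from measurable_compose[OF this] l show ?thesis by (simp add: borel_prod)
  qed
  have key: "enn2ereal (\<integral>\<^sup>+w. ennreal (v w) \<partial>\<mu>) \<le> risk l P g - opt_risk (predictors W) l P"
    if "v \<in> borel_measurable (lebesgue_on W)" "\<And>w. w \<in> W \<Longrightarrow> 0 \<le> v w"
      "\<And>w. w \<in> W \<Longrightarrow> ereal (v w) \<le> cond_regret l (\<kappa> w) (g w)" for v
    using expected_cond_regret_le[OF l' g' that(1)] that(2,3)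
    by (simp add: predictors_def space_restrict_space)
  have regret_L: "cond_regret L (\<kappa> w) (g w) = ereal (?r w)" if "w \<in> W" for w
    using cond_regret_true_loss[OF kernel_cond[OF that]] by (simp add: post_mean_def)
  have "ereal (h ?t) \<le> risk l P g - opt_risk (predictors W) l P"
    if h: "convex_on UNIV h" "\<And>t. t \<in> I \<Longrightarrow> ereal (h t) \<le> ?\<delta> t" for h
    \<comment> \<open>If all conditional infima are infinite, so are all surrogate regrets. Otherwise the calibration
      function vanishes at \<open>0\<close>, so that \<open>max 0 h\<close> is increasing on \<open>[0, \<infinity>)\<close>.\<close>
  proof (cases "\<exists>w\<in>W. \<bar>INF d. cond_risk l (\<kappa> w) d\<bar> \<noteq> \<infinity>")
    case False
    have "cond_regret l (\<kappa> w) d = \<infinity>" if w: "w \<in> W" for w d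
    proof -
      have "(INF d. cond_risk l (\<kappa> w) d) \<le> cond_risk l (\<kappa> w) d" by (rule INF_lower) simp
      then show ?thesis
        using False w unfolding cond_regret_def by (cases "INF d. cond_risk l (\<kappa> w) d") auto
    qed
    \<comment> \<open>Infinite conditional regrets admit any finite minorant, in particular the
      constant \<open>\<bar>h ?t\<bar>\<close>, whose integral against the probability
      \<open>\<mu>\<close> is itself.\<close>
    then have "enn2ereal (\<integral>\<^sup>+w. ennreal \<bar>h ?t\<bar> \<partial>\<mu>) \<le> risk l P g - opt_risk (predictors W) l P"
      by (intro key) auto
    then have "ereal \<bar>h ?t\<bar> \<le> risk l P g - opt_risk (predictors W) l P"
      using emeasure_marginal_space by simp
    then show ?thesis by (rule order_trans[rotated]) simp
  next
    case True
    then obtain w0 where "w0 \<in> W" "\<bar>INF d. cond_risk l (\<K> P w0) d\<bar> \<noteq> \<infinity>" using \<K> by auto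
    then have \<delta>0: "?\<delta> 0 \<le> 0" using P by (intro calibration_fun_0)
    define h' where "h' x = max 0 (h x)" for x
    have h': "convex_on UNIV h'" "\<And>x. 0 \<le> h' x"
      unfolding h'_def using convex_on_max_0[OF h(1)] by auto
    have h'_le: "ereal (h' x) \<le> ?\<delta> x" if "x \<in> I" for x
      using h(2)[OF that] calibration_fun_nonneg[of W \<K> \<P> L l x] by (simp add: h'_def max_def zero_ereal_def[symmetric])
    obtain w1 where "w1 \<in> W" using True by blast
    then have B0: "0 \<le> ?B" using regret_bounds[of w1 g] by linarith
    then have "0 \<in> I" using I by auto
    then have "ereal (h' 0) \<le> 0" using \<delta>0 by (rule order_trans[OF h'_le])
    then have h'0: "h' 0 = 0" using h'(2)[of 0] by simp
    have h'_meas: "h' \<in> borel_measurable borel"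
      by (intro borel_measurable_continuous_onI convex_on_continuous[OF open_UNIV h'(1)])
    have v_meas: "(\<lambda>w. h' (?r w)) \<in> borel_measurable (lebesgue_on W)"
      using measurable_compose[OF regret_measurable[OF g] h'_meas] .
    have h'_mono: "h' x \<le> h' y" if "0 \<le> x" "x \<le> y" for x y
      using convex_nonneg_le_at_larger[OF h' h'0 that] .
    have v_int: "integrable \<mu> (\<lambda>w. h' (?r w))"
      using v_meas regret_bounds h'(2) h'_mono
      by (intro marginal.integrable_const_bound[of _ "h' ?B"]) (auto simp: space_restrict_space)
    \<comment> \<open>\<open>?t\<close> may be smaller than \<open>?T\<close>, so monotonicity of
      \<open>h'\<close> is needed before Jensen's inequality.\<close>
    have "h' ?t \<le> h' ?T" using true_regret_le[OF g] by (intro h'_mono)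
    also have "h' ?T \<le> (\<integral>w. h' (?r w) \<partial>\<mu>)"
      by (rule marginal.jensens_inequality[where I=UNIV, OF regret_integrable[OF g] _ _ v_int h'(1)]) auto
    finally have "ereal (h ?t) \<le> ereal (\<integral>w. h' (?r w) \<partial>\<mu>)" by (simp add: h'_def)
    also have "\<dots> = enn2ereal (\<integral>\<^sup>+w. ennreal (h' (?r w)) \<partial>\<mu>)"
      using nn_integral_eq_integral[OF v_int] h'(2) by (simp add: integral_nonneg_AE)
    also have "\<dots> \<le> risk l P g - opt_risk (predictors W) l P"
    proof (rule key[OF v_meas])
      fix w assume w: "w \<in> W"
      show "0 \<le> h' (?r w)" by (rule h'(2))
      have "ereal (h' (?r w)) \<le> ?\<delta> (?r w)" using regret_bounds[OF w, of g] I by (intro h'_le) auto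
      also have "\<dots> \<le> cond_regret l (\<K> P w) (g w)"
        using P w regret_L[OF w] \<K> by (intro calibration_fun_le) auto
      finally show "ereal (h' (?r w)) \<le> cond_regret l (\<kappa> w) (g w)" using \<K> by simp
    qed
    finally show ?thesis .
  qed
  then show ?thesis unfolding convex_envelope_def by (intro SUP_least) auto
qed

lemma B_C_finite_bound:
  assumes "C \<noteq> {}" "B_C C < \<infinity>"
  obtains b where "B_C C = ereal b" "\<And>c. c \<in> C \<Longrightarrow> norm c \<le> b"
proof -
  have le: "ereal (norm c) \<le> B_C C" if "c \<in> C" for c
    unfolding B_C_def using that by (rule SUP_upper)
  obtain c where "c \<in> C" using assms by blast
  from le[OF this] assms(2) obtain b where "B_C C = ereal b" by (cases "B_C C") auto
  then show ?thesis using le that by simp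
qed

theorem theorem3:
  fixes X :: "(real ^ 'm) set" and f :: "real ^ 'm \<Rightarrow> real" and xs :: "real ^ 'm \<Rightarrow> real ^ 'm"
    and W :: "(real ^ 'k) set" and C :: "(real ^ 'm) set"
    and \<P> :: "((real ^ 'k) \<times> (real ^ 'm)) measure set"
    and \<kappa> :: "((real ^ 'k) \<times> (real ^ 'm)) measure \<Rightarrow> real ^ 'k \<Rightarrow> (real ^ 'm) measure"
    and l :: "real ^ 'm \<Rightarrow> real ^ 'm \<Rightarrow> real"
  assumes X: "X \<noteq> {}" "convex X" "compact X"
    and f: "convex_on X f" "continuous_on X f"
    and xs: "\<And>d. xs d \<in> sol_set X f d"
    and distr: "\<And>P. P \<in> \<P> \<Longrightarrow> distribution_on W C P"
    and cond: "\<And>P. P \<in> \<P> \<Longrightarrow> cond_distribution W C P (\<kappa> P)"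
    and l: "(\<lambda>(d, c). l d c) \<in> borel_measurable borel"
    and calibrated: "uniformly_calibrated W \<kappa> \<P> (true_loss X f xs) l"
    and BC: "B_C C < \<infinity>"
  shows "(\<forall>\<epsilon>::real. 0 < \<epsilon> \<and> ereal \<epsilon> \<le> regret_bound X f C \<longrightarrow>
            calibration_envelope X f xs W C \<kappa> \<P> l \<epsilon> > 0) \<and>
         (\<forall>P\<in>\<P>. \<forall>g\<in>true_predictors W xs.
            calibration_envelope X f xs W C \<kappa> \<P> l
              (real_of_ereal (risk (true_loss X f xs) P g
                 - opt_risk (true_predictors W xs) (true_loss X f xs) P))
            \<le> risk l P g - opt_risk (predictors W) l P)"
proof (intro conjI allI impI ballI)
  fix \<epsilon> :: real assume \<epsilon>: "0 < \<epsilon> \<and> ereal \<epsilon> \<le> regret_bound X f C"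
  \<comment> \<open>The supremum defining \<open>B_C C\<close> is -\<infinity> for empty
    \<open>C\<close>. The product with \<open>B_X X\<close> is then -\<infinity> or 0, because
    \<open>B_X X\<close> is nonnegative, so the bound still stays below \<infinity>.\<close>
  have "regret_bound X f C < \<infinity> \<or> B_C C = -\<infinity>"
    using BC by (cases "B_C C") (auto simp: regret_bound_def)
  then have "regret_bound X f C < \<infinity>"
  proof
    assume "B_C C = -\<infinity>"
    interpret decision_problem X f xs by unfold_locales (fact X f xs)+
    obtain x where "x \<in> X" using X by blast
    then have "0 \<le> B_X X" using norm_diff_le_B_X[of x x] by simp
    then show ?thesis using \<open>B_C C = -\<infinity>\<close> by (auto simp: regret_bound_def)
  qed
  then obtain B where "regret_bound X f C = ereal B" using \<epsilon> by (cases "regret_bound X f C") auto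
  then show "0 < calibration_envelope X f xs W C \<kappa> \<P> l \<epsilon>"
    unfolding calibration_envelope_def using \<epsilon>
    by (intro convex_envelope_pos[where B=B] calibration_fun_nonneg calibration_fun_mono
        calibration_fun_pos[OF calibrated]) auto
next
  fix P g assume P: "P \<in> \<P>" and g: "g \<in> true_predictors W xs"
  interpret D: disintegration P "lebesgue_on W" "restrict_space borel C" "\<kappa> P"
    by (rule disintegration_of_distribution[OF distr[OF P] cond[OF P]])
  \<comment> \<open>A probability space is nonempty, so a member of \<open>\<P>\<close> rules out
    empty \<open>C\<close> and makes \<open>B_C C\<close> a real number.\<close>
  have "C \<noteq> {}" using D.not_empty D.space_P by (auto simp: space_restrict_space)
  then obtain b where b: "B_C C = ereal b" "\<And>c. c \<in> C \<Longrightarrow> norm c \<le> b"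
    using B_C_finite_bound[OF _ BC] by metis
  interpret distribution_problem X f xs C b P W "\<kappa> P"
    by unfold_locales (use X f xs b in auto)
  show "calibration_envelope X f xs W C \<kappa> \<P> l
      (real_of_ereal (risk (true_loss X f xs) P g - opt_risk (true_predictors W xs) (true_loss X f xs) P))
    \<le> risk l P g - opt_risk (predictors W) l P"
    unfolding calibration_envelope_def
    by (rule envelope_le_surrogate_regret[where \<K>=\<kappa>, OF refl P l g]) (auto simp: regret_bound_def b)
qed

end
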